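(* Let $a\in\mathbb{C}^*$ and let $\Gamma_a\subset\mathrm{PSL}(3,\mathbb{C})$ be the group generated by the projective transformations $[[M_a]]$ and $[[B]]$ induced by $$M_a=\begin{pmatrix}a&0&0\\0&a&0\\0&0&a^{-2}\end{pmatrix},\qquad B=\begin{pmatrix}0&0&1\\1&0&0\\0&1&0\end{pmatrix}.$$ Then: (1) The Kulkarni limit set is $\Lambda_{\mathrm{Kul}}(\Gamma_a)=\overleftrightarrow{e_1,e_2}\cup\overleftrightarrow{e_1,e_3}\cup\overleftrightarrow{e_3,e_2}$. (2) $\Gamma_a$ is a virtually affine group. (3) $\Gamma_a$ is not topologically conjugate to a complex hyperbolic group. (4) $\Gamma_a$ is not topologically conjugate to an affine group. (5) The quotient $\Omega_{\mathrm{Kul}}(\Gamma_a)/\Gamma_a$ is a compact orbifold with non-empty singular locus.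
   Context: $\mathrm{PSL}(3,\mathbb{C})$ acts on $\mathbb{P}^2_{\mathbb{C}}$; $[[M]]$ is the projective transformation induced by $M\in\mathrm{SL}(3,\mathbb{C})$; $e_1,e_2,e_3\in\mathbb{P}^2_{\mathbb{C}}$ are the points given by the standard basis of $\mathbb{C}^3$; $\overleftrightarrow{p,q}$ is the complex line through $p\neq q$. Kulkarni sets, for discrete $\Gamma\subset\mathrm{PSL}(3,\mathbb{C})$: $L_0(\Gamma)$ is the closure of the set of points with infinite isotropy group; $L_1(\Gamma)$ is the closure of the set of cluster points of $\Gamma z$, where $z$ runs over $\mathbb{P}^2_{\mathbb{C}}\setminus L_0(\Gamma)$; $L_2(\Gamma)$ is the closure of the set of cluster points of $\Gamma K$, where $K$ runs over all compact subsets of $\mathbb{P}^2_{\mathbb{C}}\setminus(L_0(\Gamma)\cup L_1(\Gamma))$. Here $q$ is a cluster point of $\Gamma K$ if there are a sequence $(k_m)\subset K$ and distinct elements $\gamma_m\in\Gamma$ with $\gamma_m(k_m)\to q$. The Kulkarni limit set is $\Lambda_{\mathrm{Kul}}(\Gamma)=L_0(\Gamma)\cup L_1(\Gamma)\cup L_2(\Gamma)$ and the Kulkarni region of discontinuity is $\Omega_{\mathrm{Kul}}(\Gamma)=\mathbb{P}^2_{\mathbb{C}}\setminus\Lambda_{\mathrm{Kul}}(\Gamma)$. A group is complex hyperbolic if it is conjugate in $\mathrm{PSL}(3,\mathbb{C})$ to a subgroup of $\mathrm{PU}(2,1)$, the group of holomorphic isometries of the complex hyperbolic plane $\mathbb{H}^2_{\mathbb{C}}$;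 affine if it is conjugate in $\mathrm{PSL}(3,\mathbb{C})$ to a subgroup of $\{g\in\mathrm{PSL}(3,\mathbb{C}):g(\mathbb{C}^2)=\mathbb{C}^2\}$, where $\mathbb{C}^2=\{[z:w:1]:z,w\in\mathbb{C}\}$; virtually affine if it has an affine subgroup of finite index. $\Gamma$ is topologically conjugate to a group $\Gamma'\subset\mathrm{PSL}(3,\mathbb{C})$ if there is a homeomorphism $\phi$ of $\mathbb{P}^2_{\mathbb{C}}$ with $\phi^{-1}\Gamma\phi=\Gamma'$. The singular locus of the quotient orbifold is the image of the points with non-trivial isotropy.
   Formalization: Proved for a in C* with |a| ≠ 1. For |a| = 1 the claim fails: if a is a root of unity, Γ_a is finite and its Kulkarni limit set is empty (e.g. a = 1); otherwise Γ_a is not discrete, so its Kulkarni sets are not defined. *)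

theory Defs
  imports
    "HOL-Analysis.Analysis"
    "HOL-Algebra.Generated_Groups"
    "HOL-Algebra.Bij"
begin

section \<open>The complex projective plane\<close>

definition proj_rel :: "complex^3 \<Rightarrow> complex^3 \<Rightarrow> bool" where
  "proj_rel v w \<longleftrightarrow> v \<noteq> 0 \<and> w \<noteq> 0 \<and> (\<exists>c. c \<noteq> 0 \<and> w = c *s v)"

lemma part_equivp_proj_rel: "part_equivp proj_rel"
proof (rule part_equivpI)
  show "\<exists>v. proj_rel v v"
    by (rule exI[of _ 1]) (auto simp: proj_rel_def intro!: exI[of _ 1])
  show "symp proj_rel"
  proof (rule sympI)
    fix v w assume "proj_rel v w"
    then obtain c where c: "v \<noteq> 0" "w \<noteq> 0" "c \<noteq> 0" "w = c *s v"
      by (auto simp: proj_rel_def)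
    then have "v = inverse c *s w"
      by simp
    then show "proj_rel w v"
      unfolding proj_rel_def using c(1-3) nonzero_imp_inverse_nonzero by blast
  qed
  show "transp proj_rel"
  proof (rule transpI)
    fix u v w assume "proj_rel u v" "proj_rel v w"
    then obtain c d where "u \<noteq> 0" "w \<noteq> 0" "c \<noteq> 0" "d \<noteq> 0" "v = c *s u" "w = d *s v"
      by (auto simp: proj_rel_def)
    then show "proj_rel u w"
      unfolding proj_rel_def by (intro conjI exI[of _ "d * c"]) auto
  qed
qed

quotient_type cp2 = "complex^3" / partial: proj_rel
  by (rule part_equivp_proj_rel)

text \<open>The point \<open>[v]\<close>; unspecified for \<open>v = 0\<close>.\<close>

definition proj :: "complex^3 \<Rightarrow> cp2" where
  "proj v = abs_cp2 v"

definition coords :: "cp2 \<Rightarrow> complex^3" where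
  "coords p = rep_cp2 p"

lemma proj_rel_coords: "proj_rel (coords p) (coords p)"
  unfolding coords_def by (rule Quotient_rep_reflp[OF Quotient_cp2])

lemma coords_nonzero: "coords p \<noteq> 0"
  using proj_rel_coords[of p] by (simp add: proj_rel_def)

lemma proj_coords: "proj (coords p) = p"
  unfolding proj_def coords_def by (rule Quotient_abs_rep[OF Quotient_cp2])

lemma proj_eq_iff:
  assumes "v \<noteq> 0" "w \<noteq> 0"
  shows "proj v = proj w \<longleftrightarrow> (\<exists>c. c \<noteq> 0 \<and> w = c *s v)"
proof -
  have "proj_rel v v" "proj_rel w w"
    using assms by (auto simp: proj_rel_def intro!: exI[of _ 1])
  then show ?thesis
    using Quotient_rel[OF Quotient_cp2, of v w] assms
    by (auto simp: proj_def proj_rel_def)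
qed

instantiation cp2 :: topological_space
begin

definition open_cp2 :: "cp2 set \<Rightarrow> bool" where
  "open_cp2 U \<longleftrightarrow> open {v. v \<noteq> 0 \<and> proj v \<in> U}"

instance
proof
  have "open (- {0 :: complex^3})"
    by (intro open_Compl) simp
  moreover have "{v :: complex^3. v \<noteq> 0 \<and> proj v \<in> UNIV} = - {0}"
    by auto
  ultimately show "open (UNIV :: cp2 set)"
    by (simp add: open_cp2_def)
next
  fix S T :: "cp2 set" assume "open S" "open T"
  then have "open ({v. v \<noteq> 0 \<and> proj v \<in> S} \<inter> {v. v \<noteq> 0 \<and> proj v \<in> T})"
    by (auto simp: open_cp2_def)
  moreover have "{v. v \<noteq> 0 \<and> proj v \<in> S} \<inter> {v. v \<noteq> 0 \<and> proj v \<in> T}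
      = {v. v \<noteq> 0 \<and> proj v \<in> S \<inter> T}"
    by auto
  ultimately show "open (S \<inter> T)"
    by (simp add: open_cp2_def)
next
  fix K :: "cp2 set set" assume "\<forall>S\<in>K. open S"
  then have "open (\<Union>S\<in>K. {v. v \<noteq> 0 \<and> proj v \<in> S})"
    by (intro open_UN) (auto simp: open_cp2_def)
  moreover have "(\<Union>S\<in>K. {v. v \<noteq> 0 \<and> proj v \<in> S}) = {v. v \<noteq> 0 \<and> proj v \<in> \<Union>K}"
    by auto
  ultimately show "open (\<Union>K)"
    by (simp add: open_cp2_def)
qed

end

definition basis_pt :: "3 \<Rightarrow> cp2" where
  "basis_pt i = proj (axis i 1)"

text \<open>The complex line through \<open>p\<close> and \<open>q\<close>, for \<open>p \<noteq> q\<close>.\<close>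

definition proj_line :: "cp2 \<Rightarrow> cp2 \<Rightarrow> cp2 set" where
  "proj_line p q = {r. coords r \<in> vec.span {coords p, coords q}}"

text \<open>The affine parametrisation \<open>(z, w) \<mapsto> [z : w : 1]\<close>.\<close>

definition affine_pt :: "complex^2 \<Rightarrow> cp2" where
  "affine_pt v = proj (vector [v $ 1, v $ 2, 1])"


section \<open>The group PSL(3,C) and some classes of subgroups\<close>

text \<open>The projective transformation \<open>[[M]]\<close>; meaningful for invertible \<open>M\<close>.\<close>

definition proj_map :: "complex^3^3 \<Rightarrow> cp2 \<Rightarrow> cp2" where
  "proj_map M p = proj (M *v coords p)"

text \<open>As its action on the projective plane is faithful, PSL(3,C) is taken to be a group of
  transformations.\<close>

definition PSL3 :: "(cp2 \<Rightarrow> cp2) monoid" where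
  "PSL3 = \<lparr>carrier = {proj_map M | M. det M = 1}, mult = (\<circ>), one = id\<rparr>"

lemma matrix_mult_nonzero:
  fixes M :: "complex^3^3"
  assumes "det M \<noteq> 0" "v \<noteq> 0"
  shows "M *v v \<noteq> 0"
proof
  assume "M *v v = 0"
  obtain N where "N ** M = mat 1"
    using assms(1) by (auto simp flip: invertible_det_nz simp: invertible_def)
  then have "v = N *v (M *v v)"
    by (simp add: matrix_vector_mul_assoc)
  with \<open>M *v v = 0\<close> show False
    using assms(2) by simp
qed

lemma proj_map_proj:
  assumes "det M \<noteq> 0" "v \<noteq> 0"
  shows "proj_map M (proj v) = proj (M *v v)"
proof -
  have "proj v = proj (coords (proj v))"
    by (simp add: proj_coords)
  then obtain c where c: "c \<noteq> 0" "coords (proj v) = c *s v"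
    using proj_eq_iff[OF assms(2) coords_nonzero] by auto
  then have "M *v coords (proj v) = c *s (M *v v)"
    by (simp add: vector_scalar_commute)
  then show ?thesis
    unfolding proj_map_def
    using proj_eq_iff[OF matrix_mult_nonzero[OF assms] matrix_mult_nonzero[OF assms(1) coords_nonzero]] c(1)
    by metis
qed

lemma proj_map_mult:
  assumes "det M \<noteq> 0" "det N \<noteq> 0"
  shows "proj_map M \<circ> proj_map N = proj_map (M ** N)"
proof
  fix p
  have "proj_map M (proj_map N p) = proj (M *v (N *v coords p))"
    using proj_map_proj[OF assms(1) matrix_mult_nonzero[OF assms(2) coords_nonzero]]
    by (simp add: proj_map_def)
  then show "(proj_map M \<circ> proj_map N) p = proj_map (M ** N) p"
    by (simp add: proj_map_def matrix_vector_mul_assoc)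
qed

lemma proj_map_mat_1: "proj_map (mat 1) = id"
  by (rule ext) (simp add: proj_map_def proj_coords)

lemma group_PSL3: "group PSL3"
proof (rule groupI)
  show "\<one>\<^bsub>PSL3\<^esub> \<in> carrier PSL3"
    using proj_map_mat_1 by (force simp: PSL3_def intro: exI[of _ "mat 1"])
  fix f g h assume f: "f \<in> carrier PSL3" and g: "g \<in> carrier PSL3"
  show "f \<otimes>\<^bsub>PSL3\<^esub> g \<in> carrier PSL3"
    using f g by (auto simp: PSL3_def proj_map_mult det_mul)
  show "f \<otimes>\<^bsub>PSL3\<^esub> g \<otimes>\<^bsub>PSL3\<^esub> h = f \<otimes>\<^bsub>PSL3\<^esub> (g \<otimes>\<^bsub>PSL3\<^esub> h)"
    by (simp add: PSL3_def comp_assoc)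
  show "\<one>\<^bsub>PSL3\<^esub> \<otimes>\<^bsub>PSL3\<^esub> f = f"
    by (simp add: PSL3_def)
  obtain M where M: "f = proj_map M" "det M = 1"
    using f by (auto simp: PSL3_def)
  have "invertible M"
    using M by (simp add: invertible_det_nz)
  then obtain N where N: "N ** M = mat 1"
    by (auto simp: invertible_def)
  then have "det N = 1"
    using M det_mul[of N M] by simp
  moreover have "proj_map N \<circ> f = id"
    using M N calculation by (simp add: proj_map_mult proj_map_mat_1)
  ultimately show "\<exists>k\<in>carrier PSL3. k \<otimes>\<^bsub>PSL3\<^esub> f = \<one>\<^bsub>PSL3\<^esub>"
    by (auto simp: PSL3_def)
qed

definition conjugate_into :: "(cp2 \<Rightarrow> cp2) set \<Rightarrow> (cp2 \<Rightarrow> cp2) set \<Rightarrow> bool" where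
  "conjugate_into \<Gamma> H \<longleftrightarrow>
    (\<exists>g\<in>carrier PSL3. \<forall>\<gamma>\<in>\<Gamma>. inv\<^bsub>PSL3\<^esub> g \<otimes>\<^bsub>PSL3\<^esub> \<gamma> \<otimes>\<^bsub>PSL3\<^esub> g \<in> H)"

definition herm21 :: "complex^3 \<Rightarrow> complex^3 \<Rightarrow> complex" where
  "herm21 v w = v $ 1 * cnj (w $ 1) + v $ 2 * cnj (w $ 2) - v $ 3 * cnj (w $ 3)"

text \<open>PU(2,1) acts on the ball \<open>{[v]. herm21 v v < 0}\<close>, the projective model of the complex
  hyperbolic plane, as its group of holomorphic isometries. Every class in U(2,1) modulo scalars has
  a representative of determinant 1.\<close>

definition PU21 :: "(cp2 \<Rightarrow> cp2) set" where
  "PU21 = {proj_map M | M. det M = 1 \<and> (\<forall>v w. herm21 (M *v v) (M *v w) = herm21 v w)}"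

definition complex_hyperbolic :: "(cp2 \<Rightarrow> cp2) set \<Rightarrow> bool" where
  "complex_hyperbolic \<Gamma> \<longleftrightarrow> subgroup \<Gamma> PSL3 \<and> conjugate_into \<Gamma> PU21"

definition affine_group :: "(cp2 \<Rightarrow> cp2) set \<Rightarrow> bool" where
  "affine_group \<Gamma> \<longleftrightarrow> subgroup \<Gamma> PSL3 \<and>
    conjugate_into \<Gamma> {g \<in> carrier PSL3. g ` range affine_pt = range affine_pt}"

definition virtually_affine :: "(cp2 \<Rightarrow> cp2) set \<Rightarrow> bool" where
  "virtually_affine \<Gamma> \<longleftrightarrow> subgroup \<Gamma> PSL3 \<and>
    (\<exists>H. H \<subseteq> \<Gamma> \<and> affine_group H \<and> finite (rcosets\<^bsub>PSL3\<lparr>carrier := \<Gamma>\<rparr>\<^esub> H))"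

definition topologically_conjugate :: "(cp2 \<Rightarrow> cp2) set \<Rightarrow> (cp2 \<Rightarrow> cp2) set \<Rightarrow> bool" where
  "topologically_conjugate \<Gamma> \<Gamma>' \<longleftrightarrow>
    (\<exists>\<phi> \<psi>. homeomorphism UNIV UNIV \<phi> \<psi> \<and> (\<lambda>\<gamma>. \<psi> \<circ> \<gamma> \<circ> \<phi>) ` \<Gamma> = \<Gamma>')"


section \<open>Kulkarni sets\<close>

definition isotropy :: "(cp2 \<Rightarrow> cp2) set \<Rightarrow> cp2 \<Rightarrow> (cp2 \<Rightarrow> cp2) set" where
  "isotropy \<Gamma> p = {\<gamma> \<in> \<Gamma>. \<gamma> p = p}"

definition cluster_points :: "(cp2 \<Rightarrow> cp2) set \<Rightarrow> cp2 set \<Rightarrow> cp2 set" where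
  "cluster_points \<Gamma> K = {q. \<exists>(k :: nat \<Rightarrow> cp2) \<gamma>.
     (\<forall>m. k m \<in> K) \<and> (\<forall>m. \<gamma> m \<in> \<Gamma>) \<and> inj \<gamma> \<and> (\<lambda>m. \<gamma> m (k m)) \<longlonglongrightarrow> q}"

definition L0 :: "(cp2 \<Rightarrow> cp2) set \<Rightarrow> cp2 set" where
  "L0 \<Gamma> = closure {p. infinite (isotropy \<Gamma> p)}"

definition L1 :: "(cp2 \<Rightarrow> cp2) set \<Rightarrow> cp2 set" where
  "L1 \<Gamma> = closure (\<Union>z\<in>- L0 \<Gamma>. cluster_points \<Gamma> {z})"

definition L2 :: "(cp2 \<Rightarrow> cp2) set \<Rightarrow> cp2 set" where
  "L2 \<Gamma> = closure (\<Union>K\<in>{K. compact K \<and> K \<subseteq> - (L0 \<Gamma> \<union> L1 \<Gamma>)}. cluster_points \<Gamma> K)"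

definition Kulkarni_limit_set :: "(cp2 \<Rightarrow> cp2) set \<Rightarrow> cp2 set" where
  "Kulkarni_limit_set \<Gamma> = L0 \<Gamma> \<union> L1 \<Gamma> \<union> L2 \<Gamma>"

definition Kulkarni_region :: "(cp2 \<Rightarrow> cp2) set \<Rightarrow> cp2 set" where
  "Kulkarni_region \<Gamma> = - Kulkarni_limit_set \<Gamma>"


section \<open>Orbifolds\<close>

text \<open>Holomorphy in several variables: complex differentiability at every point (of an open set).\<close>

definition holomorphic_map_on :: "(complex^'n \<Rightarrow> complex^'m) \<Rightarrow> (complex^'n) set \<Rightarrow> bool" where
  "holomorphic_map_on f V \<longleftrightarrow>
    (\<forall>x\<in>V. \<exists>D. (f has_derivative D) (at x) \<and> (\<forall>c v. D (c *s v) = c *s D v))"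

text \<open>A chart \<open>(V, G, \<phi>)\<close> consists of an open set \<open>V\<close> of \<open>\<complex>\<^sup>n\<close>, a finite group \<open>G\<close> of
  biholomorphisms of \<open>V\<close> and a map \<open>\<phi>\<close> which induces a homeomorphism from \<open>V/G\<close> onto an open
  subset of \<open>X\<close>.\<close>

type_synonym ('n, 'b) orb_chart =
  "(complex^'n) set \<times> (complex^'n \<Rightarrow> complex^'n) set \<times> (complex^'n \<Rightarrow> 'b)"

definition orbifold_chart :: "'b topology \<Rightarrow> ('n::finite, 'b) orb_chart \<Rightarrow> bool" where
  "orbifold_chart X = (\<lambda>(V, G, \<phi>).
     open V \<and> finite G \<and> subgroup G (BijGroup V) \<and> (\<forall>g\<in>G. holomorphic_map_on g V) \<and>
     openin X (\<phi> ` V) \<and> quotient_map (top_of_set V) (subtopology X (\<phi> ` V)) \<phi> \<and>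
     (\<forall>x\<in>V. \<forall>y\<in>V. \<phi> x = \<phi> y \<longleftrightarrow> (\<exists>g\<in>G. y = g x)))"

text \<open>Two charts are compatible if points with the same image in \<open>X\<close> are always related by a
  local biholomorphism over \<open>X\<close>.\<close>

definition compatible_charts ::
    "('n::finite, 'b) orb_chart \<Rightarrow> ('n, 'b) orb_chart \<Rightarrow> bool" where
  "compatible_charts = (\<lambda>(V, G, \<phi>) (V', G', \<phi>').
     \<forall>x\<in>V. \<forall>y\<in>V'. \<phi> x = \<phi>' y \<longrightarrow>
       (\<exists>W W' f f'. open W \<and> x \<in> W \<and> W \<subseteq> V \<and> open W' \<and> y \<in> W' \<and> W' \<subseteq> V' \<and>
          homeomorphism W W' f f' \<and> holomorphic_map_on f W \<and> holomorphic_map_on f' W' \<and>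
          f x = y \<and> (\<forall>w\<in>W. \<phi>' (f w) = \<phi> w)))"

definition complex_orbifold :: "'b topology \<Rightarrow> ('n::finite, 'b) orb_chart set \<Rightarrow> bool" where
  "complex_orbifold X \<A> \<longleftrightarrow>
     Hausdorff_space X \<and> second_countable X \<and>
     (\<forall>C\<in>\<A>. orbifold_chart X C) \<and>
     (\<Union>(V, G, \<phi>)\<in>\<A>. \<phi> ` V) = topspace X \<and>
     (\<forall>C\<in>\<A>. \<forall>C'\<in>\<A>. compatible_charts C C')"


section \<open>Quotient orbifolds\<close>

definition orbit_of :: "(cp2 \<Rightarrow> cp2) set \<Rightarrow> cp2 \<Rightarrow> cp2 set" where
  "orbit_of \<Gamma> p = (\<lambda>\<gamma>. \<gamma> p) ` \<Gamma>"

definition orbit_space :: "(cp2 \<Rightarrow> cp2) set \<Rightarrow> cp2 set \<Rightarrow> cp2 set topology" where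
  "orbit_space \<Gamma> \<Omega> = topology (\<lambda>T. T \<subseteq> orbit_of \<Gamma> ` \<Omega> \<and>
     openin (top_of_set \<Omega>) {p \<in> \<Omega>. orbit_of \<Gamma> p \<in> T})"

lemma openin_orbit_space:
  "openin (orbit_space \<Gamma> \<Omega>) T \<longleftrightarrow>
     T \<subseteq> orbit_of \<Gamma> ` \<Omega> \<and> openin (top_of_set \<Omega>) {p \<in> \<Omega>. orbit_of \<Gamma> p \<in> T}"
proof -
  let ?P = "\<lambda>T. T \<subseteq> orbit_of \<Gamma> ` \<Omega> \<and> openin (top_of_set \<Omega>) {p \<in> \<Omega>. orbit_of \<Gamma> p \<in> T}"
  have "istopology ?P"
    unfolding istopology_def
  proof (intro conjI allI impI)
    fix S T assume "?P S" "?P T"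
    then have "openin (top_of_set \<Omega>)
        ({p \<in> \<Omega>. orbit_of \<Gamma> p \<in> S} \<inter> {p \<in> \<Omega>. orbit_of \<Gamma> p \<in> T})"
      by (intro openin_Int) auto
    moreover have "{p \<in> \<Omega>. orbit_of \<Gamma> p \<in> S} \<inter> {p \<in> \<Omega>. orbit_of \<Gamma> p \<in> T}
        = {p \<in> \<Omega>. orbit_of \<Gamma> p \<in> S \<inter> T}"
      by auto
    ultimately show "openin (top_of_set \<Omega>) {p \<in> \<Omega>. orbit_of \<Gamma> p \<in> S \<inter> T}"
      by simp
    show "S \<inter> T \<subseteq> orbit_of \<Gamma> ` \<Omega>"
      using \<open>?P S\<close> by auto
  next
    fix \<K> assume K: "\<forall>T\<in>\<K>. ?P T"
    then have "openin (top_of_set \<Omega>) (\<Union>T\<in>\<K>. {p \<in> \<Omega>. orbit_of \<Gamma> p \<in> T})"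
      by (intro openin_Union) auto
    moreover have "(\<Union>T\<in>\<K>. {p \<in> \<Omega>. orbit_of \<Gamma> p \<in> T}) = {p \<in> \<Omega>. orbit_of \<Gamma> p \<in> \<Union>\<K>}"
      by auto
    ultimately show "openin (top_of_set \<Omega>) {p \<in> \<Omega>. orbit_of \<Gamma> p \<in> \<Union>\<K>}"
      by simp
    show "\<Union>\<K> \<subseteq> orbit_of \<Gamma> ` \<Omega>"
      using K by auto
  qed
  then show ?thesis
    by (simp add: orbit_space_def topology_inverse')
qed

text \<open>The charts which the quotient \<open>\<Omega>/\<Gamma>\<close> inherits from the projective plane: \<open>V\<close> is the domain of a
  projective parametrisation \<open>h\<close> of an open set \<open>U \<subseteq> \<Omega>\<close> whose stabiliser \<open>S\<close> in \<open>\<Gamma>\<close> is finite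
  and which is disjoint from its translates by elements outside \<open>S\<close>; the chart group is the action
  of \<open>S\<close> read in the coordinates \<open>h\<close>, and the chart map is \<open>h\<close> followed by the quotient map.\<close>

definition quotient_atlas ::
    "(cp2 \<Rightarrow> cp2) set \<Rightarrow> cp2 set \<Rightarrow> (2, cp2 set) orb_chart set" where
  "quotient_atlas \<Gamma> \<Omega> = {(V, G, \<phi>). \<exists>g\<in>carrier PSL3.
     let h = g \<circ> affine_pt; U = h ` V; S = {\<gamma> \<in> \<Gamma>. \<gamma> ` U = U} in
       open V \<and> U \<subseteq> \<Omega> \<and> finite S \<and> (\<forall>\<gamma>\<in>\<Gamma> - S. \<gamma> ` U \<inter> U = {}) \<and>
       G = (\<lambda>\<gamma>. restrict (inv_into V h \<circ> \<gamma> \<circ> h) V) ` S \<and>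
       \<phi> = orbit_of \<Gamma> \<circ> h}"

definition singular_locus :: "(cp2 \<Rightarrow> cp2) set \<Rightarrow> cp2 set \<Rightarrow> cp2 set set" where
  "singular_locus \<Gamma> \<Omega> = orbit_of \<Gamma> ` {p \<in> \<Omega>. isotropy \<Gamma> p \<noteq> {id}}"


section \<open>The groups under consideration\<close>

definition M_mat :: "complex \<Rightarrow> complex^3^3" where
  "M_mat a = vector [vector [a, 0, 0], vector [0, a, 0], vector [0, 0, a powi (-2)]]"

definition B_mat :: "complex^3^3" where
  "B_mat = vector [vector [0, 0, 1], vector [1, 0, 0], vector [0, 1, 0]]"

text \<open>Modulo scalars \<open>M_mat a\<close> is \<open>diag (1, 1, a powi (-3))\<close>, so for \<open>a \<noteq> 0\<close> this group is infinite
  and discrete exactly if \<open>cmod a \<noteq> 1\<close>: it is finite if \<open>a\<close> is a root of unity, and not discrete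
  for the other \<open>a\<close> on the unit circle.\<close>

definition Gamma_a :: "complex \<Rightarrow> (cp2 \<Rightarrow> cp2) set" where
  "Gamma_a a = generate PSL3 {proj_map (M_mat a), proj_map B_mat}"

end

theory Submission
  imports Defs
begin

text \<open>
  Modulo scalars, \<open>M_mat a\<close> is \<open>diag (l, l, 1)\<close> with \<open>l = a^3\<close>, and conjugation by the cyclic
  permutation \<open>B_mat\<close> moves the distinguished entry to the other two places. So the group consists
  of the maps \<open>diag (l^m, l^n, 1)\<close> with integers \<open>m, n\<close>, composed with powers of the
  permutation (\<open>Gamma_a_eq\<close>); it is an extension of a rank two lattice by the cyclic group of
  order three. Replacing \<open>l\<close> by its inverse does not change the group, so \<open>cmod l < 1\<close> may be assumed.

  The points without a vanishing homogeneous coordinate form an open torus. The logarithms of the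
  absolute values of its coordinates, modulo adding a common constant, form a plane on which the
  lattice acts by translations and the permutation by a linear symmetry. Hence the action on the torus is
  properly discontinuous (\<open>finite_bounded_log_spread\<close>), orbits cluster only on the three coordinate
  lines, and every point of these lines is fixed by infinitely many diagonal maps. This gives the
  limit set. The quotient of the torus is a quotient of the product of two elliptic curves
  \<open>\<complex>\<^sup>*/l\<^sup>\<int>\<close> by the permutation: it is compact because one annulus in each coordinate meets every
  orbit, and singular because the permutation fixes \<open>[1:1:1]\<close>. That it is an orbifold is a general
  fact about properly discontinuous projective actions on a subset of the affine chart
  (\<open>complex_orbifold_orbit_space\<close>). The diagonal maps preserve the affine chart and have index three, so the
  group is virtually affine.

  Both negative statements rest on the single map \<open>diag (l, l, 1)\<close>, whose fixed points are a line and
  one point off the line which attracts every point off the line. Suppose that a homeomorphism \<open>\<psi>\<close>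
  conjugates it to the projective map of a matrix \<open>N\<close>. The topology of the fixed point set forces
  \<open>N\<close> to have a two-dimensional eigenspace, in which the image of the fixed line lies, and an
  eigenvector for another eigenvalue which spans the image of the isolated fixed point
  (\<open>eigenvalue_pair_exists\<close>). In particular, the images of the three basis points are not collinear.
  Attraction forces the two eigenvalues to have different absolute values
  (\<open>eigenvalue_norms_differ\<close>). But preserving a nondegenerate Hermitian form of signature (2,1) forces
  both to have absolute value one: the eigenspace is too large to be isotropic, and a vector which is
  orthogonal to everything is zero. If, on the other hand, the conjugated group were affine, it would
  preserve a line; its preimage under \<open>\<psi>\<close> is closed and invariant under the original group, hence contains
  all three basis points by attraction and permutation, and so their images would be collinear.
\<close>

section \<open>Topology of the projective plane\<close>

lemma zero_vec3_iff: "v = 0 \<longleftrightarrow> v $ 1 = 0 \<and> v $ 2 = 0 \<and> v $ 3 = 0" for v :: "complex^3"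
  by (auto simp: vec_eq_iff forall_3)

lemma coords_proj:
  assumes "v \<noteq> 0"
  obtains c where "c \<noteq> 0" "coords (proj v) = c *s v"
  using proj_eq_iff[OF assms coords_nonzero, of "proj v"] proj_coords[of "proj v"] by auto

lemma cp2_cases:
  obtains v where "v \<noteq> 0" "p = proj v"
  using coords_nonzero[of p] proj_coords[of p] by metis

lemma proj_scale: "c \<noteq> 0 \<Longrightarrow> v \<noteq> 0 \<Longrightarrow> proj (c *s v) = proj v"
  using proj_eq_iff[of v "c *s v"] by auto

text \<open>A property of nonzero vectors that is invariant under scaling may be tested on any
  representative of a point, not only on the chosen one.\<close>

lemma homogeneous_coords_iff:
  assumes "\<And>c v. c \<noteq> 0 \<Longrightarrow> P (c *s v) \<longleftrightarrow> P v" "v \<noteq> 0"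
  shows "P (coords (proj v)) \<longleftrightarrow> P v"
proof -
  obtain c where "c \<noteq> 0" "coords (proj v) = c *s v"
    by (rule coords_proj[OF assms(2)])
  then show ?thesis
    using assms(1)[of c v] by simp
qed

lemma open_cp2_homogeneous:
  assumes "\<And>c v. c \<noteq> 0 \<Longrightarrow> P (c *s v) \<longleftrightarrow> P v" "open {v :: complex^3. v \<noteq> 0 \<and> P v}"
  shows "open {p. P (coords p)}"
proof -
  have "{v. v \<noteq> 0 \<and> proj v \<in> {p. P (coords p)}} = {v. v \<noteq> 0 \<and> P v}"
    using homogeneous_coords_iff[of P] assms(1) by blast
  then show ?thesis
    using assms(2) by (simp add: open_cp2_def)
qed

lemma continuous_on_proj: "continuous_on (- {0}) proj"
proof -
  have "open (- {0 :: complex^3})"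
    by (intro open_Compl) simp
  moreover have "proj -` B \<inter> - {0} = {v. v \<noteq> 0 \<and> proj v \<in> B}" for B
    by auto
  ultimately show ?thesis
    by (simp add: continuous_on_open_vimage open_cp2_def)
qed

lemma continuous_on_proj_compose:
  assumes "continuous_on S f" "\<And>x. x \<in> S \<Longrightarrow> f x \<noteq> 0"
  shows "continuous_on S (\<lambda>x. proj (f x))"
  by (rule continuous_on_compose2[OF continuous_on_proj assms(1)]) (use assms(2) in auto)

lemma tendsto_proj:
  assumes "(f \<longlongrightarrow> v) F" "v \<noteq> 0"
  shows "((\<lambda>x. proj (f x)) \<longlongrightarrow> proj v) F"
proof (rule continuous_on_tendsto_compose[OF continuous_on_proj assms(1)])
  have "open (- {0 :: complex^3})"
    by (intro open_Compl) simp
  then show "\<forall>\<^sub>F x in F. f x \<in> - {0}"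
    using topological_tendstoD[OF assms(1)] assms(2) by blast
qed (use assms(2) in auto)

text \<open>The topology is the quotient topology, so continuity of a function may be checked after composing
  with \<open>proj\<close>.\<close>

lemma continuous_on_cp2:
  assumes "open U" "continuous_on {v. v \<noteq> 0 \<and> proj v \<in> U} (\<lambda>v. f (proj v))"
  shows "continuous_on U f"
proof -
  let ?W = "{v. v \<noteq> 0 \<and> proj v \<in> U}"
  have "open ?W"
    using assms(1) by (simp add: open_cp2_def)
  have "open (f -` B \<inter> U)" if "open B" for B
  proof -
    have "open ((\<lambda>v. f (proj v)) -` B \<inter> ?W)"
      using assms(2) \<open>open ?W\<close> that by (simp add: continuous_on_open_vimage)
    moreover have "(\<lambda>v. f (proj v)) -` B \<inter> ?W = {v. v \<noteq> 0 \<and> proj v \<in> f -` B \<inter> U}"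
      by auto
    ultimately show ?thesis
      by (simp add: open_cp2_def)
  qed
  then show ?thesis
    using assms(1) by (simp add: continuous_on_open_vimage)
qed

section \<open>Projective transformations\<close>

lemma continuous_on_matrix_vector_mult: "continuous_on S (\<lambda>v. (M :: complex^'n^'m) *v v)"
  unfolding matrix_vector_mult_def by (intro continuous_intros)

lemma continuous_proj_map:
  assumes "det M \<noteq> 0"
  shows "continuous_on S (proj_map M)"
proof -
  have "continuous_on (- {0}) (\<lambda>v. proj (M *v v))"
    by (intro continuous_on_proj_compose continuous_on_matrix_vector_mult)
       (use matrix_mult_nonzero[OF assms] in auto)
  then have "continuous_on (- {0}) (\<lambda>v. proj_map M (proj v))"
    by (rule continuous_on_eq) (simp add: proj_map_proj[OF assms])
  moreover have "{v. v \<noteq> 0 \<and> proj v \<in> UNIV} = - {0}"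
    by auto
  ultimately have "continuous_on UNIV (proj_map M)"
    by (intro continuous_on_cp2) auto
  then show ?thesis
    using continuous_on_subset by blast
qed

lemma proj_map_scale:
  assumes "c \<noteq> 0" "det M \<noteq> 0" "\<And>v. N *v v = c *s (M *v v)"
  shows "proj_map N = proj_map M"
  using proj_scale[OF assms(1) matrix_mult_nonzero[OF assms(2) coords_nonzero]]
  by (auto simp: proj_map_def assms(3))

text \<open>Over the complex numbers every invertible matrix can be rescaled to determinant 1.\<close>

lemma proj_map_in_PSL3:
  assumes "det M \<noteq> 0"
  shows "proj_map M \<in> carrier PSL3"
proof -
  define c where "c = (1 / det M) powr (1/3)"
  have c: "c ^ 3 = 1 / det M"
    using assms by (simp add: c_def powr_def flip: exp_of_nat_mult)
  then have "c \<noteq> 0"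
    using assms by auto
  define N where "N = (\<chi> i j. c * M $ i $ j)"
  have "det N = c ^ 3 * det M"
    by (simp add: N_def det_3 power3_eq_cube algebra_simps)
  then have "det N = 1"
    using c assms by simp
  moreover have "N *v v = c *s (M *v v)" for v
    by (simp add: N_def vec_eq_iff matrix_vector_mult_def sum_distrib_left mult.assoc)
  then have "proj_map N = proj_map M"
    by (rule proj_map_scale[OF \<open>c \<noteq> 0\<close> assms])
  ultimately show ?thesis
    by (auto simp: PSL3_def intro: exI[of _ N])
qed

lemma PSL3_simps: "x \<otimes>\<^bsub>PSL3\<^esub> y = x \<circ> y" "\<one>\<^bsub>PSL3\<^esub> = id"
  by (simp_all add: PSL3_def)

lemma PSL3_cases:
  assumes "g \<in> carrier PSL3"
  obtains M where "det M = 1" "g = proj_map M"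
  using assms by (auto simp: PSL3_def)

text \<open>The abstract inverse in the group is the inverse map.\<close>

lemma PSL3_inverse:
  assumes "g \<in> carrier PSL3"
  shows "inv\<^bsub>PSL3\<^esub> g \<in> carrier PSL3" "inv\<^bsub>PSL3\<^esub> g \<circ> g = id" "g \<circ> inv\<^bsub>PSL3\<^esub> g = id"
    "(inv\<^bsub>PSL3\<^esub> g) (g p) = p" "g ((inv\<^bsub>PSL3\<^esub> g) p) = p"
proof -
  interpret group PSL3 by (rule group_PSL3)
  show *: "inv\<^bsub>PSL3\<^esub> g \<in> carrier PSL3" "inv\<^bsub>PSL3\<^esub> g \<circ> g = id" "g \<circ> inv\<^bsub>PSL3\<^esub> g = id"
    using l_inv[OF assms] r_inv[OF assms] inv_closed[OF assms] by (simp_all add: PSL3_simps)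
  show "(inv\<^bsub>PSL3\<^esub> g) (g p) = p" "g ((inv\<^bsub>PSL3\<^esub> g) p) = p"
    using *(2,3) by (metis comp_apply id_apply)+
qed

lemma PSL3_inverse_eq:
  assumes "g \<in> carrier PSL3" "h \<in> carrier PSL3" "h \<circ> g = id"
  shows "inv\<^bsub>PSL3\<^esub> g = h"
  using group.inv_equality[OF group_PSL3 _ assms(1,2)] assms(3) by (simp add: PSL3_simps)

lemma PSL3_comp: "g \<in> carrier PSL3 \<Longrightarrow> h \<in> carrier PSL3 \<Longrightarrow> g \<circ> h \<in> carrier PSL3"
  using monoid.m_closed[OF group.is_monoid[OF group_PSL3]] by (simp add: PSL3_simps)

lemma PSL3_continuous: "g \<in> carrier PSL3 \<Longrightarrow> continuous_on S g"
  using PSL3_cases continuous_proj_map by (metis zero_neq_one)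

lemma PSL3_homeomorphism:
  "g \<in> carrier PSL3 \<Longrightarrow> homeomorphism UNIV UNIV g (inv\<^bsub>PSL3\<^esub> g)"
  by (simp add: homeomorphism_def PSL3_continuous PSL3_inverse) (metis PSL3_inverse(4,5) surjI)

lemma PSL3_open_image:
  assumes "g \<in> carrier PSL3" "open U"
  shows "open (g ` U)"
  using homeomorphism_imp_open_map[OF PSL3_homeomorphism[OF assms(1)], of U] assms(2) by simp

section \<open>The affine chart\<close>

definition affine_coords :: "cp2 \<Rightarrow> complex^2" where
  "affine_coords p = vector [coords p $ 1 / coords p $ 3, coords p $ 2 / coords p $ 3]"

lemma affine_vec_nonzero: "vector [x, y, 1 :: complex] \<noteq> (0 :: complex^3)"
  by (simp add: zero_vec3_iff)

lemma affine_coords_proj: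
  assumes "v \<noteq> 0"
  shows "affine_coords (proj v) = vector [v $ 1 / v $ 3, v $ 2 / v $ 3]"
proof -
  obtain c where "c \<noteq> 0" "coords (proj v) = c *s v"
    by (rule coords_proj[OF assms])
  then show ?thesis
    by (simp add: affine_coords_def)
qed

lemma affine_coords_affine_pt [simp]: "affine_coords (affine_pt x) = x"
  unfolding affine_pt_def affine_coords_proj[OF affine_vec_nonzero]
  by (auto simp: vec_eq_iff forall_2)

lemma coords_proj_zero_iff: "v \<noteq> 0 \<Longrightarrow> coords (proj v) $ i = 0 \<longleftrightarrow> v $ i = 0"
  by (rule homogeneous_coords_iff[of "\<lambda>v. v $ i = 0"]) auto

lemma range_affine_pt: "range affine_pt = {p. coords p $ 3 \<noteq> 0}"
proof (intro equalityI subsetI)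
  fix p assume "p \<in> {p. coords p $ 3 \<noteq> 0}"
  then have p: "coords p $ 3 \<noteq> 0"
    by simp
  have "affine_pt (affine_coords p) = p"
    unfolding affine_pt_def
    by (subst (3) proj_coords[of p, symmetric], subst proj_eq_iff[OF affine_vec_nonzero coords_nonzero])
       (auto simp: vec_eq_iff forall_3 affine_coords_def p intro!: exI[of _ "coords p $ 3"])
  then show "p \<in> range affine_pt"
    by (metis rangeI)
qed (auto simp: affine_pt_def coords_proj_zero_iff affine_vec_nonzero)

lemma inj_affine_pt: "inj affine_pt"
  by (metis affine_coords_affine_pt injI)

lemma open_coord_nonzero: "open {p. coords p $ i \<noteq> 0}"
proof (rule open_cp2_homogeneous[of "\<lambda>v. v $ i \<noteq> 0"])
  have "open {v :: complex^3. v $ i \<noteq> 0}"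
    by (intro open_Collect_neq continuous_intros)
  moreover have "{v :: complex^3. v \<noteq> 0 \<and> v $ i \<noteq> 0} = {v. v $ i \<noteq> 0}"
    by auto
  ultimately show "open {v :: complex^3. v \<noteq> 0 \<and> v $ i \<noteq> 0}"
    by simp
qed auto

lemma open_range_affine_pt: "open (range affine_pt)"
  by (simp add: range_affine_pt open_coord_nonzero)

lemma vector_2_lambda: "(vector [x, y] :: 'a::zero^2) = (\<chi> i. if i = 1 then x else y)"
  by (auto simp: vec_eq_iff forall_2)

lemma vector_3_lambda:
  "(vector [x, y, z] :: 'a::zero^3) = (\<chi> i. if i = 1 then x else if i = 2 then y else z)"
  by (auto simp: vec_eq_iff forall_3)

lemma continuous_on_vector_2:
  fixes f g :: "'a::topological_space \<Rightarrow> complex"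
  assumes "continuous_on S f" "continuous_on S g"
  shows "continuous_on S (\<lambda>x. vector [f x, g x] :: complex^2)"
  unfolding vector_2_lambda
proof (rule continuous_on_vec_lambda)
  show "continuous_on S (\<lambda>x. if i = 1 then f x else g x)" for i :: 2
    using assms by (cases "i = 1") auto
qed

lemma continuous_on_vector_3:
  fixes f g h :: "'a::topological_space \<Rightarrow> complex"
  assumes "continuous_on S f" "continuous_on S g" "continuous_on S h"
  shows "continuous_on S (\<lambda>x. vector [f x, g x, h x] :: complex^3)"
  unfolding vector_3_lambda
proof (rule continuous_on_vec_lambda)
  show "continuous_on S (\<lambda>x. if i = 1 then f x else if i = 2 then g x else h x)" for i :: 3
    using assms by (cases "i = 1"; cases "i = 2") auto
qed

lemma continuous_affine_pt: "continuous_on S affine_pt"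
  unfolding affine_pt_def
  by (intro continuous_on_proj_compose continuous_on_vector_3 continuous_intros affine_vec_nonzero)

lemma continuous_affine_coords: "continuous_on (range affine_pt) affine_coords"
proof (rule continuous_on_cp2[OF open_range_affine_pt])
  let ?W = "{v. v \<noteq> 0 \<and> proj v \<in> range affine_pt}"
  have "v $ 3 \<noteq> 0" if "v \<in> ?W" for v
    using that by (auto simp: range_affine_pt coords_proj_zero_iff)
  then have "continuous_on ?W (\<lambda>v. vector [v $ 1 / v $ 3, v $ 2 / v $ 3] :: complex^2)"
    by (intro continuous_on_vector_2 continuous_intros) auto
  then show "continuous_on ?W (\<lambda>v. affine_coords (proj v))"
    by (rule continuous_on_eq) (simp add: affine_coords_proj)
qed

lemma open_image_affine_pt:
  assumes "open V"
  shows "open (affine_pt ` V)"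
proof -
  have "affine_pt ` V = affine_coords -` V \<inter> range affine_pt"
    by force
  then show ?thesis
    using continuous_affine_coords assms open_range_affine_pt by (simp add: continuous_on_open_vimage)
qed

section \<open>The group as a lattice of diagonal maps extended by a cyclic permutation\<close>

definition diag_mat :: "complex \<Rightarrow> complex \<Rightarrow> complex \<Rightarrow> complex^3^3" where
  "diag_mat x y z = vector [vector [x, 0, 0], vector [0, y, 0], vector [0, 0, z]]"

text \<open>The last entry is normalised to 1 so that \<open>x\<close> and \<open>y\<close> are determined by the projective map.\<close>

definition tor :: "complex \<Rightarrow> complex \<Rightarrow> cp2 \<Rightarrow> cp2" where
  "tor x y = proj_map (diag_mat x y 1)"

definition cyc :: "cp2 \<Rightarrow> cp2" where
  "cyc = proj_map B_mat"

lemma diag_mat_mult_vec: "diag_mat x y z *v v = vector [x * v $ 1, y * v $ 2, z * v $ 3]"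
  by (simp add: vec_eq_iff forall_3 matrix_vector_mult_def sum_3 diag_mat_def)

lemma det_diag_mat: "det (diag_mat x y z) = x * y * z"
  by (simp add: det_3 diag_mat_def)

lemma B_mat_mult_vec: "B_mat *v v = vector [v $ 3, v $ 1, v $ 2]"
  by (simp add: vec_eq_iff forall_3 matrix_vector_mult_def sum_3 B_mat_def)

lemma det_B_mat: "det B_mat = 1"
  by (simp add: det_3 B_mat_def)

lemma tor_proj:
  "x \<noteq> 0 \<Longrightarrow> y \<noteq> 0 \<Longrightarrow> v \<noteq> 0 \<Longrightarrow> tor x y (proj v) = proj (vector [x * v $ 1, y * v $ 2, v $ 3])"
  by (simp add: tor_def proj_map_proj det_diag_mat diag_mat_mult_vec)

lemma cyc_proj: "v \<noteq> 0 \<Longrightarrow> cyc (proj v) = proj (vector [v $ 3, v $ 1, v $ 2])"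
  by (simp add: cyc_def proj_map_proj det_B_mat B_mat_mult_vec)

lemma tor_in_PSL3: "x \<noteq> 0 \<Longrightarrow> y \<noteq> 0 \<Longrightarrow> tor x y \<in> carrier PSL3"
  unfolding tor_def by (rule proj_map_in_PSL3) (simp add: det_diag_mat)

lemma cyc_in_PSL3: "cyc \<in> carrier PSL3"
  unfolding cyc_def by (rule proj_map_in_PSL3) (simp add: det_B_mat)

lemma tor_1: "tor 1 1 = id"
proof
  fix p
  obtain v where v: "v \<noteq> 0" "p = proj v"
    by (rule cp2_cases)
  have "vector [v $ 1, v $ 2, v $ 3] = v"
    by (simp add: vec_eq_iff forall_3)
  then show "tor 1 1 p = id p"
    by (simp add: v tor_proj)
qed

lemma tor_tor:
  assumes "x \<noteq> 0" "y \<noteq> 0" "x' \<noteq> 0" "y' \<noteq> 0"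
  shows "tor x y (tor x' y' p) = tor (x * x') (y * y') p"
proof -
  obtain v where v: "v \<noteq> 0" "p = proj v"
    by (rule cp2_cases)
  have "vector [x' * v $ 1, y' * v $ 2, v $ 3] \<noteq> (0 :: complex^3)"
    using v(1) assms by (auto simp: zero_vec3_iff)
  then show ?thesis
    by (simp add: v tor_proj assms mult.assoc)
qed

text \<open>The permutation moves the normalised entry 1 to the first place; dividing by the entry \<open>y\<close>, which
  is now the last one, restores the normalisation and mixes \<open>x\<close> with \<open>y\<close>.\<close>

lemma cyc_tor:
  assumes "x \<noteq> 0" "y \<noteq> 0"
  shows "cyc (tor x y p) = tor (1 / y) (x / y) (cyc p)"
proof -
  obtain v where v: "v \<noteq> 0" "p = proj v"
    by (rule cp2_cases)
  have nz: "vector [x * v $ 1, y * v $ 2, v $ 3] \<noteq> (0 :: complex^3)" "vector [v $ 3, v $ 1, v $ 2] \<noteq> (0 :: complex^3)"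
    "vector [v $ 3 / y, x * v $ 1 / y, v $ 2] \<noteq> (0 :: complex^3)"
    using v(1) assms by (auto simp: zero_vec3_iff)
  have "(vector [v $ 3, x * v $ 1, y * v $ 2] :: complex^3) = y *s vector [v $ 3 / y, x * v $ 1 / y, v $ 2]"
    using assms by (simp add: vec_eq_iff forall_3)
  then show ?thesis
    using proj_scale[OF assms(2) nz(3)] by (simp add: v tor_proj cyc_proj assms nz)
qed

lemma cyc_cubed: "cyc (cyc (cyc p)) = p"
proof -
  obtain v where v: "v \<noteq> 0" "p = proj v"
    by (rule cp2_cases)
  have "vector [v $ 3, v $ 1, v $ 2] \<noteq> (0 :: complex^3)" "vector [v $ 2, v $ 3, v $ 1] \<noteq> (0 :: complex^3)"
    "vector [v $ 1, v $ 2, v $ 3] = v"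
    using v(1) by (simp_all add: zero_vec3_iff) (auto simp: vec_eq_iff forall_3)
  then show ?thesis
    by (simp add: v cyc_proj)
qed

text \<open>The image of \<open>[1:1:1]\<close> has the affine coordinates \<open>(x, y)\<close>.\<close>

lemma tor_eq_iff:
  assumes "x \<noteq> 0" "y \<noteq> 0" "x' \<noteq> 0" "y' \<noteq> 0"
  shows "tor x y = tor x' y' \<longleftrightarrow> x = x' \<and> y = y'"
proof
  assume "tor x y = tor x' y'"
  then have "tor x y (proj (vector [1, 1, 1])) = tor x' y' (proj (vector [1, 1, 1]))"
    by simp
  then have "affine_pt (vector [x, y]) = affine_pt (vector [x', y'])"
    using assms by (simp add: tor_proj affine_vec_nonzero affine_pt_def)
  then have "(vector [x, y] :: complex^2) = vector [x', y']"
    by (rule injD[OF inj_affine_pt])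
  then show "x = x' \<and> y = y'"
    by (simp add: vec_eq_iff forall_2)
qed simp

text \<open>Admitting all natural exponents \<open>r\<close>, rather than only those below 3, makes closure under
  composition evident.\<close>

definition lattice_group :: "complex \<Rightarrow> (cp2 \<Rightarrow> cp2) set" where
  "lattice_group l = {tor (l powi m) (l powi n) \<circ> cyc ^^ r | m n r. True}"

lemma lattice_groupI: "tor (l powi m) (l powi n) \<circ> cyc ^^ r \<in> lattice_group l"
  by (auto simp: lattice_group_def)

lemma tor_in_lattice_group: "tor (l powi m) (l powi n) \<in> lattice_group l"
  using lattice_groupI[of l m n 0] by simp

lemma cyc_in_lattice_group: "cyc \<in> lattice_group l"
  using lattice_groupI[of l 0 0 1] by (simp add: tor_1)

lemma cyc_pow_mod: "cyc ^^ (r mod 3) = cyc ^^ r"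
  by (rule ext, rule funpow_mod_eq) (simp add: eval_nat_numeral cyc_cubed)

lemma lattice_group_cases:
  assumes "g \<in> lattice_group l"
  obtains m n r where "r < 3" "g = tor (l powi m) (l powi n) \<circ> cyc ^^ r"
proof -
  obtain m n r where "g = tor (l powi m) (l powi n) \<circ> cyc ^^ r"
    using assms by (auto simp: lattice_group_def)
  then show ?thesis
    using that[of "r mod 3" m n] by (simp add: cyc_pow_mod)
qed

text \<open>The lattice of diagonal maps is normalised by the permutation, which is what makes the products a
  group.\<close>

lemma cyc_pow_tor:
  assumes "l \<noteq> 0"
  shows "\<exists>m' n'. \<forall>p. (cyc ^^ r) (tor (l powi m) (l powi n) p)
    = tor (l powi m') (l powi n') ((cyc ^^ r) p)"
proof (induction r)
  case (Suc r)
  then obtain m' n' where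
    "\<And>p. (cyc ^^ r) (tor (l powi m) (l powi n) p) = tor (l powi m') (l powi n') ((cyc ^^ r) p)"
    by blast
  then have "(cyc ^^ Suc r) (tor (l powi m) (l powi n) p)
      = tor (l powi (- n')) (l powi (m' - n')) ((cyc ^^ Suc r) p)" for p
    using assms by (simp add: cyc_tor power_int_minus power_int_diff inverse_eq_divide)
  then show ?case
    by blast
qed auto

lemma cyc_pow_in_PSL3: "cyc ^^ r \<in> carrier PSL3"
proof (induction r)
  case 0
  then show ?case
    using group.is_monoid[OF group_PSL3, THEN monoid.one_closed] by (simp add: PSL3_simps id_def)
next
  case (Suc r)
  then show ?case
    using PSL3_comp[OF cyc_in_PSL3] by (simp add: comp_def)
qed

lemma subgroup_lattice_group:
  assumes l: "l \<noteq> 0"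
  shows "subgroup (lattice_group l) PSL3"
proof (rule group.subgroupI[OF group_PSL3])
  show sub: "lattice_group l \<subseteq> carrier PSL3"
    using l by (auto simp: lattice_group_def intro!: PSL3_comp tor_in_PSL3 cyc_pow_in_PSL3)
  show "lattice_group l \<noteq> {}"
    using cyc_in_lattice_group by auto
  show comp: "g \<otimes>\<^bsub>PSL3\<^esub> h \<in> lattice_group l"
    if gh: "g \<in> lattice_group l" "h \<in> lattice_group l" for g h
  proof -
    obtain m n r where g: "g = tor (l powi m) (l powi n) \<circ> cyc ^^ r"
      by (rule lattice_group_cases[OF gh(1)])
    obtain m' n' r' where h: "h = tor (l powi m') (l powi n') \<circ> cyc ^^ r'"
      by (rule lattice_group_cases[OF gh(2)])
    obtain i j where ij: "\<And>p. (cyc ^^ r) (tor (l powi m') (l powi n') p)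
        = tor (l powi i) (l powi j) ((cyc ^^ r) p)"
      using cyc_pow_tor[OF l, of r m' n'] by blast
    have "g \<circ> h = tor (l powi (m + i)) (l powi (n + j)) \<circ> cyc ^^ (r + r')"
      using l by (auto simp: fun_eq_iff g h ij tor_tor power_int_add funpow_add)
    then show ?thesis
      by (simp add: PSL3_simps lattice_groupI)
  qed
  show "inv\<^bsub>PSL3\<^esub> g \<in> lattice_group l" if g: "g \<in> lattice_group l" for g
  proof -
    obtain m n r where g': "g = tor (l powi m) (l powi n) \<circ> cyc ^^ r"
      by (rule lattice_group_cases[OF g])
    \<comment> \<open>As the permutation has order 3, its power \<open>2 * r\<close> is inverse to its power \<open>r\<close>.\<close>
    define h where "h = cyc ^^ (2 * r) \<circ> tor (l powi (- m)) (l powi (- n))"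
    have "cyc ^^ (2 * r) \<in> lattice_group l"
      using lattice_groupI[of l 0 0 "2 * r"] by (simp add: tor_1)
    then have h: "h \<in> lattice_group l"
      using comp tor_in_lattice_group by (auto simp: h_def PSL3_simps)
    have "(cyc ^^ (2 * r)) ((cyc ^^ r) p) = p" for p
    proof -
      have "(cyc ^^ (2 * r)) ((cyc ^^ r) p) = (cyc ^^ (3 * r)) p"
        by (simp flip: funpow_add comp_apply[of "cyc ^^ (2 * r)"])
      also have "\<dots> = (cyc ^^ (3 * r mod 3)) p"
        by (simp only: cyc_pow_mod)
      finally show ?thesis
        by simp
    qed
    then have "h \<circ> g = id"
      using l by (auto simp: fun_eq_iff h_def g' tor_tor power_int_minus tor_1)
    then have "inv\<^bsub>PSL3\<^esub> g = h"
      using PSL3_inverse_eq sub g h by blast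
    then show ?thesis
      using h by simp
  qed
qed

text \<open>Divide by the last entry \<open>1 / a ^ 2\<close>.\<close>

lemma M_mat_eq_tor:
  assumes "a \<noteq> 0"
  shows "proj_map (M_mat a) = tor (a ^ 3) (a ^ 3)"
  unfolding tor_def
proof (rule proj_map_scale[where c = "1 / a ^ 2"])
  show "M_mat a *v v = (1 / a ^ 2) *s (diag_mat (a ^ 3) (a ^ 3) 1 *v v)" for v
    using assms unfolding diag_mat_mult_vec
    by (simp add: M_mat_def vec_eq_iff forall_3 matrix_vector_mult_def sum_3 power_int_minus
        field_simps eval_nat_numeral)
qed (use assms in \<open>auto simp: det_diag_mat\<close>)

lemma tor_powi:
  assumes "subgroup H PSL3" "tor x y \<in> H" "x \<noteq> 0" "y \<noteq> 0"
  shows "tor (x powi m) (y powi m) \<in> H"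
proof -
  interpret subgroup H PSL3
    by (rule assms)
  have inv: "inv\<^bsub>PSL3\<^esub> (tor x y) = tor (1 / x) (1 / y)" if "x \<noteq> 0" "y \<noteq> 0" for x y
    using that by (intro PSL3_inverse_eq) (auto simp: tor_in_PSL3 tor_tor tor_1 fun_eq_iff)
  have nat: "tor (x ^ k) (y ^ k) \<in> H" for k
  proof (induction k)
    case 0
    then show ?case
      using one_closed by (simp add: tor_1 PSL3_simps id_def)
  next
    case (Suc k)
    have "tor (x ^ Suc k) (y ^ Suc k) = tor x y \<circ> tor (x ^ k) (y ^ k)"
      using assms by (auto simp: tor_tor fun_eq_iff)
    then show ?case
      using m_closed[OF assms(2) Suc] by (simp only: PSL3_simps)
  qed
  show ?thesis
  proof (cases "m \<ge> 0")
    case True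
    then show ?thesis
      using nat[of "nat m"] by (simp add: power_int_def)
  next
    case False
    then show ?thesis
      using m_inv_closed[OF nat[of "nat (- m)"]] assms inv
      by (simp add: power_int_def power_inverse inverse_eq_divide power_one_over)
  qed
qed

text \<open>The conjugates of \<open>diag (l, l, 1)\<close> by the permutation are, up to scalars, \<open>diag (1/l, 1, 1)\<close> and
  \<open>diag (1, 1/l, 1)\<close>, and these two generate the whole lattice.\<close>

lemma Gamma_a_eq:
  assumes a: "a \<noteq> 0"
  shows "Gamma_a a = lattice_group (a ^ 3)"
proof
  have "{proj_map (M_mat a), proj_map B_mat} \<subseteq> lattice_group (a ^ 3)"
    using tor_in_lattice_group[of "a ^ 3" 1 1] cyc_in_lattice_group
    by (simp add: M_mat_eq_tor[OF a] cyc_def)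
  then show "Gamma_a a \<subseteq> lattice_group (a ^ 3)"
    unfolding Gamma_a_def
    using group.generate_subgroup_incl[OF group_PSL3 _ subgroup_lattice_group] a by simp
next
  define l where "l = a ^ 3"
  have l: "l \<noteq> 0"
    using a by (simp add: l_def)
  have gens: "{proj_map (M_mat a), proj_map B_mat} \<subseteq> carrier PSL3"
    using tor_in_PSL3[OF l l] cyc_in_PSL3 by (simp add: M_mat_eq_tor[OF a] cyc_def l_def)
  then have sub: "subgroup (Gamma_a a) PSL3"
    unfolding Gamma_a_def by (rule group.generate_is_subgroup[OF group_PSL3])
  interpret subgroup "Gamma_a a" PSL3
    by (rule sub)
  have gen: "tor l l \<in> Gamma_a a" "cyc \<in> Gamma_a a"
    unfolding Gamma_a_def using M_mat_eq_tor[OF a]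
    by (auto simp: cyc_def l_def intro: generate.incl)
  have closed: "g \<circ> h \<in> Gamma_a a" if "g \<in> Gamma_a a" "h \<in> Gamma_a a" for g h
    using m_closed[OF that] by (simp add: PSL3_simps)
  have cyc_pow: "cyc ^^ r \<in> Gamma_a a" for r
  proof (induction r)
    case 0
    then show ?case
      using one_closed by (simp add: PSL3_simps id_def)
  next
    case (Suc r)
    then show ?case
      using closed[OF gen(2)] by (simp add: comp_def)
  qed
  have conj: "tor (1 / y) (x / y) \<in> Gamma_a a" if "tor x y \<in> Gamma_a a" "x \<noteq> 0" "y \<noteq> 0" for x y
  proof -
    have "tor (1 / y) (x / y) = cyc \<circ> tor x y \<circ> cyc ^^ 2"
      using that by (simp add: fun_eq_iff cyc_tor eval_nat_numeral cyc_cubed)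
    then show ?thesis
      using closed cyc_pow gen that by auto
  qed
  have "tor (1 / l) 1 \<in> Gamma_a a"
    using conj[OF gen(1)] l by simp
  moreover from conj[OF this] have "tor 1 (1 / l) \<in> Gamma_a a"
    using l by simp
  ultimately have "tor ((1 / l) powi (- m)) 1 \<in> Gamma_a a" "tor 1 ((1 / l) powi (- n)) \<in> Gamma_a a"
    for m n
    using tor_powi[OF sub, of "1 / l" 1 "- m"] tor_powi[OF sub, of 1 "1 / l" "- n"] l by simp_all
  then have "tor (l powi m) 1 \<in> Gamma_a a" "tor 1 (l powi n) \<in> Gamma_a a" for m n
    by (simp_all add: power_int_minus power_int_divide_distrib)
  then have "tor (l powi m) 1 \<circ> tor 1 (l powi n) \<in> Gamma_a a" for m n
    by (rule closed)
  moreover have "tor (l powi m) 1 \<circ> tor 1 (l powi n) = tor (l powi m) (l powi n)" for m n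
    using l by (auto simp: tor_tor fun_eq_iff)
  ultimately show "lattice_group (a ^ 3) \<subseteq> Gamma_a a"
    using closed cyc_pow by (auto simp: lattice_group_def l_def)
qed


section \<open>Proper discontinuity on the complement of the coordinate lines\<close>

definition torus :: "cp2 set" where
  "torus = {p. \<forall>i. coords p $ i \<noteq> 0}"

text \<open>A norm on the logarithms of the absolute values of the coordinates modulo the diagonal. It does
  not depend on the representative, as scaling adds a constant to all three logarithms, and it is
  symmetric in the coordinates, hence invariant under the permutation.\<close>

definition log_spread :: "cp2 \<Rightarrow> real" where
  "log_spread p = (let l = (\<lambda>i. ln (cmod (coords p $ i))) in
     \<bar>l 1 - l 2\<bar> + \<bar>l 2 - l 3\<bar> + \<bar>l 1 - l 3\<bar>)"

lemma proj_in_torus_iff: "v \<noteq> 0 \<Longrightarrow> proj v \<in> torus \<longleftrightarrow> v $ 1 \<noteq> 0 \<and> v $ 2 \<noteq> 0 \<and> v $ 3 \<noteq> 0"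
  by (simp add: torus_def coords_proj_zero_iff forall_3)

lemma torus_cases:
  assumes "p \<in> torus"
  obtains v where "v \<noteq> 0" "v $ 1 \<noteq> 0" "v $ 2 \<noteq> 0" "v $ 3 \<noteq> 0" "p = proj v"
  using assms proj_in_torus_iff by (metis cp2_cases)

lemma open_torus: "open torus"
proof -
  have "torus = {p. coords p $ 1 \<noteq> 0} \<inter> {p. coords p $ 2 \<noteq> 0} \<inter> {p. coords p $ 3 \<noteq> 0}"
    by (auto simp: torus_def forall_3)
  moreover have "open \<dots>"
    by (intro open_Int open_coord_nonzero)
  ultimately show ?thesis
    by simp
qed

lemma log_spread_proj:
  assumes "v \<noteq> 0" "v $ 1 \<noteq> 0" "v $ 2 \<noteq> 0" "v $ 3 \<noteq> 0"
  shows "log_spread (proj v) =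
    \<bar>ln (cmod (v $ 1)) - ln (cmod (v $ 2))\<bar> + \<bar>ln (cmod (v $ 2)) - ln (cmod (v $ 3))\<bar>
      + \<bar>ln (cmod (v $ 1)) - ln (cmod (v $ 3))\<bar>"
proof -
  obtain c where "c \<noteq> 0" "coords (proj v) = c *s v"
    by (rule coords_proj[OF assms(1)])
  then show ?thesis
    using assms by (simp add: log_spread_def norm_mult ln_mult)
qed

lemma continuous_log_spread: "continuous_on torus log_spread"
proof (rule continuous_on_cp2[OF open_torus])
  let ?W = "{v. v \<noteq> 0 \<and> proj v \<in> torus}"
  have nz: "v $ 1 \<noteq> 0 \<and> v $ 2 \<noteq> 0 \<and> v $ 3 \<noteq> 0" if "v \<in> ?W" for v
    using that by (auto simp: proj_in_torus_iff)
  then have "continuous_on ?W (\<lambda>v. 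
    \<bar>ln (cmod (v $ 1)) - ln (cmod (v $ 2))\<bar> + \<bar>ln (cmod (v $ 2)) - ln (cmod (v $ 3))\<bar>
      + \<bar>ln (cmod (v $ 1)) - ln (cmod (v $ 3))\<bar>)"
    by (intro continuous_intros) auto
  then show "continuous_on ?W (\<lambda>v. log_spread (proj v))"
    by (rule continuous_on_eq) (use nz in \<open>simp add: log_spread_proj\<close>)
qed

lemma cyc_torus:
  assumes "p \<in> torus"
  shows "cyc p \<in> torus" "log_spread (cyc p) = log_spread p"
proof -
  obtain v where v: "v \<noteq> 0" "v $ 1 \<noteq> 0" "v $ 2 \<noteq> 0" "v $ 3 \<noteq> 0" "p = proj v"
    by (rule torus_cases[OF assms])
  have nz: "vector [v $ 3, v $ 1, v $ 2] \<noteq> (0 :: complex^3)"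
    using v by (simp add: zero_vec3_iff)
  then show "cyc p \<in> torus" "log_spread (cyc p) = log_spread p"
    using v by (simp_all add: cyc_proj proj_in_torus_iff log_spread_proj)
qed

lemma cyc_pow_torus:
  assumes "p \<in> torus"
  shows "(cyc ^^ r) p \<in> torus \<and> log_spread ((cyc ^^ r) p) = log_spread p"
  by (induction r) (auto simp: assms cyc_torus)

text \<open>A diagonal map translates the differences of the logarithms by \<open>ln (cmod x)\<close> and \<open>ln (cmod y)\<close>, so
  a large translation cannot keep a point inside a bounded region.\<close>

lemma tor_torus:
  assumes "p \<in> torus" "x \<noteq> 0" "y \<noteq> 0"
  shows "tor x y p \<in> torus"
    "\<bar>ln (cmod x)\<bar> \<le> log_spread (tor x y p) + log_spread p"
    "\<bar>ln (cmod y)\<bar> \<le> log_spread (tor x y p) + log_spread p"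
proof -
  obtain v where v: "v \<noteq> 0" "v $ 1 \<noteq> 0" "v $ 2 \<noteq> 0" "v $ 3 \<noteq> 0" "p = proj v"
    by (rule torus_cases[OF assms(1)])
  have nz: "vector [x * v $ 1, y * v $ 2, v $ 3] \<noteq> (0 :: complex^3)"
    using v by (simp add: zero_vec3_iff)
  show "tor x y p \<in> torus"
    using v assms nz by (simp add: tor_proj proj_in_torus_iff)
  have "log_spread (tor x y p) =
      \<bar>ln (cmod x) + ln (cmod (v $ 1)) - (ln (cmod y) + ln (cmod (v $ 2)))\<bar>
      + \<bar>ln (cmod y) + ln (cmod (v $ 2)) - ln (cmod (v $ 3))\<bar>
      + \<bar>ln (cmod x) + ln (cmod (v $ 1)) - ln (cmod (v $ 3))\<bar>"
    using v assms nz by (simp add: tor_proj log_spread_proj norm_mult ln_mult)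
  then show "\<bar>ln (cmod x)\<bar> \<le> log_spread (tor x y p) + log_spread p"
    "\<bar>ln (cmod y)\<bar> \<le> log_spread (tor x y p) + log_spread p"
    using log_spread_proj[OF v(1-4)] unfolding v(5) by linarith+
qed

lemma lattice_group_torus:
  assumes "l \<noteq> 0" "g \<in> lattice_group l" "p \<in> torus"
  shows "g p \<in> torus"
proof -
  obtain m n r where "g = tor (l powi m) (l powi n) \<circ> cyc ^^ r"
    by (rule lattice_group_cases[OF assms(2)])
  then show ?thesis
    using cyc_pow_torus[OF assms(3), of r] tor_torus(1) assms(1) by auto
qed

lemma ln_cmod_power_int:
  assumes "l \<noteq> (0 :: complex)"
  shows "ln (cmod (l powi m)) = of_int m * ln (cmod l)"
  using assms by (simp add: power_int_def norm_power norm_inverse ln_realpow ln_inverse power_inverse)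

lemma finite_bounded_ints:
  assumes "0 < (c :: real)"
  shows "finite {m :: int. \<bar>of_int m\<bar> * c \<le> C}"
proof (rule finite_subset)
  show "{m :: int. \<bar>of_int m\<bar> * c \<le> C} \<subseteq> {- \<lceil>C / c\<rceil>..\<lceil>C / c\<rceil>}"
  proof
    fix m :: int assume "m \<in> {m. \<bar>of_int m\<bar> * c \<le> C}"
    then have "\<bar>of_int m\<bar> \<le> C / c"
      using assms by (simp add: pos_le_divide_eq)
    then have "\<bar>m\<bar> \<le> \<lceil>C / c\<rceil>"
      by linarith
    then show "m \<in> {- \<lceil>C / c\<rceil>..\<lceil>C / c\<rceil>}"
      by auto
  qed
qed simp

text \<open>This is proper discontinuity on the torus: the sublevel sets of \<open>log_spread\<close> exhaust it, and
  only finitely many group elements move a point of one of them into the same one.\<close>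

lemma finite_bounded_log_spread:
  assumes l: "l \<noteq> 0" "cmod l \<noteq> 1"
  shows "finite {g \<in> lattice_group l. \<exists>p\<in>torus. log_spread p \<le> C \<and> log_spread (g p) \<le> C}"
    (is "finite ?F")
proof -
  define c where "c = \<bar>ln (cmod l)\<bar>"
  have "0 < c"
    using l by (simp add: c_def)
  define I where "I = {m :: int. \<bar>of_int m\<bar> * c \<le> 2 * C}"
  have powi: "\<bar>ln (cmod (l powi m))\<bar> = \<bar>of_int m\<bar> * c" for m
    using l by (simp add: ln_cmod_power_int c_def abs_mult)
  have "?F \<subseteq> (\<lambda>(m, n, r). tor (l powi m) (l powi n) \<circ> cyc ^^ r) ` (I \<times> I \<times> {..<3})"
  proof
    fix g assume "g \<in> ?F"
    then obtain p where g: "g \<in> lattice_group l" and p: "p \<in> torus" "log_spread p \<le> C"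
      "log_spread (g p) \<le> C"
      by blast
    obtain m n r where r: "r < 3" and g': "g = tor (l powi m) (l powi n) \<circ> cyc ^^ r"
      by (rule lattice_group_cases[OF g])
    have *: "(cyc ^^ r) p \<in> torus" "log_spread ((cyc ^^ r) p) = log_spread p"
      using cyc_pow_torus[OF p(1)] by auto
    have "\<bar>of_int m\<bar> * c \<le> 2 * C" "\<bar>of_int n\<bar> * c \<le> 2 * C"
      using tor_torus(2,3)[OF *(1), of "l powi m" "l powi n"] l p(2,3) by (simp_all add: powi g' *)
    then show "g \<in> (\<lambda>(m, n, r). tor (l powi m) (l powi n) \<circ> cyc ^^ r) ` (I \<times> I \<times> {..<3})"
      using r by (force simp: I_def g')
  qed
  moreover have "finite I"
    unfolding I_def by (rule finite_bounded_ints[OF \<open>0 < c\<close>])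
  ultimately show ?thesis
    by (meson finite_SigmaI finite_imageI finite_lessThan finite_subset)
qed

section \<open>The Kulkarni limit set\<close>

lemma not_torus_eq:
  "- torus = {p. coords p $ 1 = 0} \<union> {p. coords p $ 2 = 0} \<union> {p. coords p $ 3 = 0}"
  by (auto simp: torus_def forall_3)

text \<open>If the third coordinate vanishes, the maps \<open>diag (l^m, l^m, 1)\<close> act on the point as scalars; if
  one of the others vanishes, multiplying that coordinate by \<open>l^m\<close> has no effect.\<close>

lemma infinite_isotropy_iff:
  assumes l: "l \<noteq> 0" "cmod l \<noteq> 1"
  shows "infinite (isotropy (lattice_group l) p) \<longleftrightarrow> p \<notin> torus"
proof
  assume "infinite (isotropy (lattice_group l) p)"
  moreover have "finite (isotropy (lattice_group l) p)" if "p \<in> torus"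
    by (rule finite_subset[OF _ finite_bounded_log_spread[OF l, of "log_spread p"]])
       (use that in \<open>auto simp: isotropy_def\<close>)
  ultimately show "p \<notin> torus"
    by blast
next
  assume "p \<notin> torus"
  obtain v where v: "v \<noteq> 0" "p = proj v"
    by (rule cp2_cases)
  have inj: "inj (\<lambda>m. l powi m)"
  proof (rule injI)
    fix i j assume "l powi i = l powi j"
    then have "ln (cmod (l powi i)) = ln (cmod (l powi j))"
      by simp
    then show "i = j"
      using l by (simp add: ln_cmod_power_int)
  qed
  define f where "f = (\<lambda>m. if v $ 1 = 0 then tor (l powi m) 1 else if v $ 2 = 0 then tor 1 (l powi m)
    else tor (l powi m) (l powi m))"
  have "inj f"
    using inj l by (auto simp: inj_def f_def tor_eq_iff)
  moreover have "f m \<in> isotropy (lattice_group l) p" for m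
  proof -
    have "f m \<in> lattice_group l"
      using tor_in_lattice_group[of l m 0] tor_in_lattice_group[of l 0 m]
      by (simp add: f_def tor_in_lattice_group)
    moreover have "f m p = p"
    proof -
      have zero: "v $ 1 = 0 \<or> v $ 2 = 0 \<or> v $ 3 = 0"
        using \<open>p \<notin> torus\<close> v by (simp add: proj_in_torus_iff)
      show ?thesis
      proof (cases "v $ 1 = 0 \<or> v $ 2 = 0")
        case True
        have "(vector [l powi m * v $ 1, v $ 2, v $ 3] :: complex^3) = v" if "v $ 1 = 0"
          using that by (simp add: vec_eq_iff forall_3)
        moreover have "(vector [v $ 1, l powi m * v $ 2, v $ 3] :: complex^3) = v" if "v $ 2 = 0"
          using that by (simp add: vec_eq_iff forall_3)
        ultimately show ?thesis
          using True l by (auto simp: f_def v tor_proj)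
      next
        case False
        then have "(vector [l powi m * v $ 1, l powi m * v $ 2, v $ 3] :: complex^3) = l powi m *s v"
          using zero by (simp add: vec_eq_iff forall_3)
        then show ?thesis
          using False l by (simp add: f_def v tor_proj proj_scale)
      qed
    qed
    ultimately show ?thesis
      by (simp add: isotropy_def)
  qed
  ultimately show "infinite (isotropy (lattice_group l) p)"
    by (meson finite_imageD finite_subset image_subsetI infinite_UNIV_int)
qed

lemma compact_log_spread_bounded:
  assumes "compact K" "K \<subseteq> torus"
  shows "\<exists>C. \<forall>p\<in>K. log_spread p \<le> C"
proof -
  have "compact (log_spread ` K)"
    using assms continuous_log_spread by (intro compact_continuous_image) (auto intro: continuous_on_subset)
  then have "bdd_above (log_spread ` K)"
    by (intro bounded_imp_bdd_above compact_imp_bounded)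
  then show ?thesis
    by (auto simp: bdd_above_def)
qed

text \<open>Near a cluster point inside the torus \<open>log_spread\<close> is bounded, and it is bounded on \<open>K\<close>; then
  only finitely many group elements could occur in the sequence, which consists of distinct ones.\<close>

lemma cluster_points_not_torus:
  assumes l: "l \<noteq> 0" "cmod l \<noteq> 1" and K: "compact K" "K \<subseteq> torus"
  shows "cluster_points (lattice_group l) K \<subseteq> - torus"
proof
  fix q assume "q \<in> cluster_points (lattice_group l) K"
  then obtain k :: "nat \<Rightarrow> cp2" and g where k: "\<And>m. k m \<in> K" and g: "\<And>m. g m \<in> lattice_group l"
    and inj: "inj g" and lim: "(\<lambda>m. g m (k m)) \<longlonglongrightarrow> q"
    unfolding cluster_points_def by blast
  obtain C where C: "\<And>p. p \<in> K \<Longrightarrow> log_spread p \<le> C"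
    using compact_log_spread_bounded[OF K] by blast
  show "q \<in> - torus"
  proof
    assume q: "q \<in> torus"
    have "g m (k m) \<in> torus" for m
      using lattice_group_torus[OF l(1) g] k K by blast
    then have "(\<lambda>m. log_spread (g m (k m))) \<longlonglongrightarrow> log_spread q"
      by (intro continuous_on_tendsto_compose[OF continuous_log_spread lim q]) auto
    then have "\<forall>\<^sub>F m in sequentially. log_spread (g m (k m)) < log_spread q + 1"
      by (rule order_tendstoD) simp
    then obtain N where N: "\<And>m. m \<ge> N \<Longrightarrow> log_spread (g m (k m)) < log_spread q + 1"
      by (auto simp: eventually_sequentially)
    let ?D = "max C (log_spread q + 1)"
    have "g ` {N..} \<subseteq>
        {g \<in> lattice_group l. \<exists>p\<in>torus. log_spread p \<le> ?D \<and> log_spread (g p) \<le> ?D}"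
    proof clarify
      fix m assume "N \<le> m"
      then have "k m \<in> torus" "log_spread (k m) \<le> ?D" "log_spread (g m (k m)) \<le> ?D"
        using k K C[OF k] N[of m] by (auto intro: less_imp_le max.coboundedI1 max.coboundedI2)
      then show "g m \<in> lattice_group l \<and>
          (\<exists>p\<in>torus. log_spread p \<le> ?D \<and> log_spread (g m p) \<le> ?D)"
        using g by blast
    qed
    then have "finite (g ` {N..})"
      using finite_bounded_log_spread[OF l] finite_subset by blast
    then have "finite {N..}"
      using inj finite_imageD inj_on_subset by blast
    then show False
      by (simp add: infinite_Ici)
  qed
qed

lemma Kulkarni_limit_set_lattice_group:
  assumes l: "l \<noteq> 0" "cmod l \<noteq> 1"
  shows "Kulkarni_limit_set (lattice_group l) = - torus"
proof -
  have closed: "closed (- torus)"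
    using open_torus by auto
  have L0: "L0 (lattice_group l) = - torus"
    using closure_closed[OF closed] by (simp add: L0_def infinite_isotropy_iff[OF l] Compl_eq)
  have "L1 (lattice_group l) \<subseteq> - torus"
    unfolding L1_def L0 using cluster_points_not_torus[OF l]
    by (intro closure_minimal closed UN_least) auto
  moreover have "L2 (lattice_group l) \<subseteq> - torus"
    unfolding L2_def L0 using cluster_points_not_torus[OF l]
    by (intro closure_minimal closed UN_least) auto
  ultimately show ?thesis
    by (auto simp: Kulkarni_limit_set_def L0)
qed

lemma proj_line_basis_pt:
  assumes "i \<noteq> j" "k \<noteq> i" "k \<noteq> j"
  shows "proj_line (basis_pt i) (basis_pt j) = {p. coords p $ k = 0}"
proof -
  have all: "P i \<and> P j \<and> P k \<longleftrightarrow> (\<forall>m :: 3. P m)" for P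
    using assms by (metis (full_types) exhaust_3)
  have nz: "axis m 1 \<noteq> (0 :: complex^3)" for m
    by (simp add: axis_eq_0_iff)
  obtain c where c: "c \<noteq> 0" "coords (basis_pt i) = c *s axis i 1"
    unfolding basis_pt_def by (rule coords_proj[OF nz])
  obtain d where d: "d \<noteq> 0" "coords (basis_pt j) = d *s axis j 1"
    unfolding basis_pt_def by (rule coords_proj[OF nz])
  have "v \<in> vec.span {c *s axis i 1, d *s axis j 1} \<longleftrightarrow> v $ k = 0" for v
  proof -
    have "v \<in> vec.span {c *s axis i 1, d *s axis j 1} \<longleftrightarrow>
        (\<exists>s t. v - s *s (c *s axis i 1) - t *s (d *s axis j 1) = 0)"
      by (simp add: vec.span_breakdown_eq)
    also have "\<dots> \<longleftrightarrow> (\<exists>s t. v $ i = s * c \<and> v $ j = t * d \<and> v $ k = 0)"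
      using assms by (auto simp: vec_eq_iff axis_def simp flip: all)
    also have "\<dots> \<longleftrightarrow> v $ k = 0"
      using c(1) d(1) by (auto intro: exI[of _ "v $ i / c"] exI[of _ "v $ j / d"])
    finally show ?thesis .
  qed
  then show ?thesis
    by (simp add: proj_line_def c d)
qed

section \<open>Quotients of properly discontinuous projective actions\<close>

lemma has_derivative_vector_2:
  fixes f g :: "complex^2 \<Rightarrow> complex"
  assumes "(f has_derivative f') (at x)" "(g has_derivative g') (at x)"
  shows "((\<lambda>x. vector [f x, g x] :: complex^2) has_derivative (\<lambda>h. vector [f' h, g' h])) (at x)"
proof (subst has_derivative_componentwise_within, rule ballI)
  fix b :: "complex^2" assume "b \<in> Basis"
  then obtain i c where b: "b = axis i c"
    by (auto simp: Basis_vec_def)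
  then show "((\<lambda>x. vector [f x, g x] \<bullet> b) has_derivative (\<lambda>h. vector [f' h, g' h] \<bullet> b)) (at x)"
    using exhaust_2[of i] has_derivative_inner_left[OF assms(1)] has_derivative_inner_left[OF assms(2)]
    by (auto simp: inner_axis)
qed

text \<open>In the affine chart a projective transformation is given by quotients of affine functions with a
  common denominator, which does not vanish where the image lies in the chart.\<close>

lemma holomorphic_map_on_projective:
  assumes "open V" "g \<in> carrier PSL3" "\<And>x. x \<in> V \<Longrightarrow> affine_pt (f x) = g (affine_pt x)"
  shows "holomorphic_map_on f V"
  unfolding holomorphic_map_on_def
proof
  fix x assume x: "x \<in> V"
  obtain M where M: "det M = 1" "g = proj_map M"
    by (rule PSL3_cases[OF assms(2)])
  define n where "n = (\<lambda>i (y :: complex^2). M $ i $ 1 * y $ 1 + M $ i $ 2 * y $ 2 + M $ i $ 3)"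
  define L where "L = (\<lambda>i (y :: complex^2). M $ i $ 1 * y $ 1 + M $ i $ 2 * y $ 2)"
  have n: "(M *v vector [y $ 1, y $ 2, 1]) $ i = n i y" for i y
    by (simp add: n_def matrix_vector_mult_def sum_3)
  have nz: "M *v vector [y $ 1, y $ 2, 1] \<noteq> 0" for y :: "complex^2"
    by (rule matrix_mult_nonzero) (simp_all add: M affine_vec_nonzero)
  have g: "g (affine_pt y) = proj (M *v vector [y $ 1, y $ 2, 1])" for y
    by (simp add: M affine_pt_def proj_map_proj affine_vec_nonzero)
  have f: "f y = vector [n 1 y / n 3 y, n 2 y / n 3 y]" if "y \<in> V" for y
  proof -
    have "f y = affine_coords (g (affine_pt y))"
      using assms(3)[OF that] by (metis affine_coords_affine_pt)
    then show ?thesis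
      by (simp add: g affine_coords_proj[OF nz] n)
  qed
  have "g (affine_pt x) \<in> range affine_pt"
    using assms(3)[OF x] by (metis rangeI)
  then have n3: "n 3 x \<noteq> 0"
    by (simp add: g range_affine_pt coords_proj_zero_iff[OF nz] n)
  define D where "D = (\<lambda>h. vector [(L 1 h * n 3 x - n 1 x * L 3 h) / (n 3 x * n 3 x),
    (L 2 h * n 3 x - n 2 x * L 3 h) / (n 3 x * n 3 x)] :: complex^2)"
  have nth: "((\<lambda>y :: complex^2. y $ i) has_derivative (\<lambda>y. y $ i)) (at x)" for i
    by (rule bounded_linear_imp_has_derivative[OF bounded_linear_vec_nth])
  have "(n i has_derivative L i) (at x)" for i
    unfolding n_def L_def by (rule derivative_eq_intros nth refl)+ simp
  then have "((\<lambda>y. vector [n 1 y / n 3 y, n 2 y / n 3 y] :: complex^2) has_derivative D) (at x)"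
    unfolding D_def by (intro has_derivative_vector_2 has_derivative_divide' n3)
  then have "(f has_derivative D) (at x)"
    by (rule has_derivative_transform_within_open[OF _ assms(1) x]) (simp add: f)
  moreover have "D (c *s v) = c *s D v" for c v
    by (simp add: D_def L_def vec_eq_iff forall_2 algebra_simps)
  ultimately show "\<exists>D. (f has_derivative D) (at x) \<and> (\<forall>c v. D (c *s v) = c *s D v)"
    by blast
qed

lemma continuous_on_projective:
  assumes "g \<in> carrier PSL3" "\<And>x. x \<in> V \<Longrightarrow> affine_pt (f x) = g (affine_pt x)"
  shows "continuous_on V f"
proof -
  have "continuous_on V (\<lambda>x. g (affine_pt x))"
    by (rule continuous_on_compose2[OF PSL3_continuous[OF assms(1)] continuous_affine_pt]) auto
  then have "continuous_on V (\<lambda>x. affine_coords (g (affine_pt x)))"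
    by (rule continuous_on_compose2[OF continuous_affine_coords]) (metis assms(2) image_subsetI rangeI)
  moreover have "affine_coords (g (affine_pt x)) = f x" if "x \<in> V" for x
    using assms(2)[OF that] by (metis affine_coords_affine_pt)
  ultimately show ?thesis
    by (simp cong: continuous_on_cong)
qed

text \<open>Two points of one chart are separated by the images of disjoint open sets of the chart.\<close>

lemma affine_pt_separation:
  assumes "p \<in> range affine_pt" "q \<in> range affine_pt" "p \<noteq> q"
  obtains A B where "open A" "open B" "p \<in> A" "q \<in> B" "A \<inter> B = {}"
proof -
  obtain x y where xy: "p = affine_pt x" "q = affine_pt y"
    using assms by blast
  then obtain U V where "open U" "open V" "x \<in> U" "y \<in> V" "U \<inter> V = {}"
    using assms(3) hausdorff[of x y] by blast
  then show ?thesis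
    using that[of "affine_pt ` U" "affine_pt ` V"] inj_affine_pt xy
    by (auto simp: open_image_affine_pt simp flip: image_Int)
qed

lemma PSL3_chart:
  assumes "g \<in> carrier PSL3" "open V"
  shows "continuous_on V (g \<circ> affine_pt)" "inj (g \<circ> affine_pt)" "open ((g \<circ> affine_pt) ` V)"
proof -
  show "continuous_on V (g \<circ> affine_pt)"
    by (intro continuous_on_compose continuous_affine_pt PSL3_continuous assms)
  show "inj (g \<circ> affine_pt)"
    using inj_affine_pt PSL3_inverse(4)[OF assms(1)] by (metis inj_compose injI)
  show "open ((g \<circ> affine_pt) ` V)"
    using PSL3_open_image[OF assms(1) open_image_affine_pt[OF assms(2)]] by (simp add: image_comp)
qed

lemma second_countable_euclidean:
  "second_countable (euclidean :: 'a::second_countable_topology topology)"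
proof -
  obtain \<B> :: "'a set set" where B: "countable \<B>" "topological_basis \<B>"
    using ex_countable_basis by blast
  then show ?thesis
    unfolding second_countable_def
    using topological_basis_open[OF B(2)] topological_basisE[OF B(2)]
    by (intro exI[of _ \<B>] conjI allI impI ballI) (simp_all, metis)
qed

text \<open>The whole domain \<open>\<Omega>\<close> lies in the standard affine chart. This gives its Hausdorff property and
  lets the standard parametrisation serve for a chart around each of its points.\<close>

locale proper_action =
  fixes \<Gamma> :: "(cp2 \<Rightarrow> cp2) set" and \<Omega> :: "cp2 set"
  assumes subgroup: "subgroup \<Gamma> PSL3"
    and open_domain: "open \<Omega>"
    and domain_affine: "\<Omega> \<subseteq> range affine_pt"
    and invariant: "\<gamma> \<in> \<Gamma> \<Longrightarrow> p \<in> \<Omega> \<Longrightarrow> \<gamma> p \<in> \<Omega>"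
    and proper: "p \<in> \<Omega> \<Longrightarrow> q \<in> \<Omega> \<Longrightarrow>
      \<exists>A B. open A \<and> open B \<and> p \<in> A \<and> q \<in> B \<and> finite {\<gamma> \<in> \<Gamma>. \<gamma> ` A \<inter> B \<noteq> {}}"
begin

abbreviation "X \<equiv> orbit_space \<Gamma> \<Omega>"

lemma in_PSL3: "\<gamma> \<in> \<Gamma> \<Longrightarrow> \<gamma> \<in> carrier PSL3"
  using subgroup.subset[OF subgroup] by blast

lemma id_in: "id \<in> \<Gamma>"
  using subgroup.one_closed[OF subgroup] by (simp only: PSL3_simps)

lemma comp_in: "\<gamma> \<in> \<Gamma> \<Longrightarrow> \<delta> \<in> \<Gamma> \<Longrightarrow> \<gamma> \<circ> \<delta> \<in> \<Gamma>"
  using subgroup.m_closed[OF subgroup] by (simp only: PSL3_simps)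

lemma inv_in: "\<gamma> \<in> \<Gamma> \<Longrightarrow> inv\<^bsub>PSL3\<^esub> \<gamma> \<in> \<Gamma>"
  by (rule subgroup.m_inv_closed[OF subgroup])

lemma inv_apply [simp]:
  "\<gamma> \<in> \<Gamma> \<Longrightarrow> (inv\<^bsub>PSL3\<^esub> \<gamma>) (\<gamma> p) = p" "\<gamma> \<in> \<Gamma> \<Longrightarrow> \<gamma> ((inv\<^bsub>PSL3\<^esub> \<gamma>) p) = p"
  by (simp_all add: in_PSL3 PSL3_inverse)

lemma orbit_ofI: "\<gamma> \<in> \<Gamma> \<Longrightarrow> r = \<gamma> p \<Longrightarrow> r \<in> orbit_of \<Gamma> p"
  by (simp add: orbit_of_def)

lemma orbit_of_eq_iff: "orbit_of \<Gamma> p = orbit_of \<Gamma> q \<longleftrightarrow> (\<exists>\<gamma>\<in>\<Gamma>. q = \<gamma> p)"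
proof
  assume "orbit_of \<Gamma> p = orbit_of \<Gamma> q"
  moreover have "q \<in> orbit_of \<Gamma> q"
    by (rule orbit_ofI[OF id_in]) simp
  ultimately show "\<exists>\<gamma>\<in>\<Gamma>. q = \<gamma> p"
    by (auto simp: orbit_of_def)
next
  assume "\<exists>\<gamma>\<in>\<Gamma>. q = \<gamma> p"
  then obtain \<gamma> where g: "\<gamma> \<in> \<Gamma>" "q = \<gamma> p"
    by blast
  show "orbit_of \<Gamma> p = orbit_of \<Gamma> q"
  proof (intro equalityI subsetI)
    fix r assume "r \<in> orbit_of \<Gamma> p"
    then obtain \<delta> where "\<delta> \<in> \<Gamma>" "r = \<delta> p"
      by (auto simp: orbit_of_def)
    then show "r \<in> orbit_of \<Gamma> q"
      using g comp_in[OF _ inv_in[OF g(1)], of \<delta>] by (intro orbit_ofI[of "\<delta> \<circ> inv\<^bsub>PSL3\<^esub> \<gamma>"]) auto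
  next
    fix r assume "r \<in> orbit_of \<Gamma> q"
    then obtain \<delta> where "\<delta> \<in> \<Gamma>" "r = \<delta> q"
      by (auto simp: orbit_of_def)
    then show "r \<in> orbit_of \<Gamma> p"
      using g comp_in[OF _ g(1), of \<delta>] by (intro orbit_ofI[of "\<delta> \<circ> \<gamma>"]) auto
  qed
qed

text \<open>The quotient map is open because the saturation of an open set is the union of its translates.\<close>

lemma openin_orbit_image:
  assumes "open U" "U \<subseteq> \<Omega>"
  shows "openin X (orbit_of \<Gamma> ` U)"
proof -
  have "{p \<in> \<Omega>. orbit_of \<Gamma> p \<in> orbit_of \<Gamma> ` U} = (\<Union>\<gamma>\<in>\<Gamma>. \<gamma> ` U)"
  proof (intro equalityI subsetI)
    fix p assume "p \<in> {p \<in> \<Omega>. orbit_of \<Gamma> p \<in> orbit_of \<Gamma> ` U}"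
    then obtain u where "u \<in> U" "orbit_of \<Gamma> u = orbit_of \<Gamma> p"
      by auto
    then show "p \<in> (\<Union>\<gamma>\<in>\<Gamma>. \<gamma> ` U)"
      by (auto simp: orbit_of_eq_iff)
  next
    fix p assume "p \<in> (\<Union>\<gamma>\<in>\<Gamma>. \<gamma> ` U)"
    then obtain \<gamma> u where u: "\<gamma> \<in> \<Gamma>" "u \<in> U" "p = \<gamma> u"
      by blast
    then have "orbit_of \<Gamma> u = orbit_of \<Gamma> p" "p \<in> \<Omega>"
      using invariant assms(2) by (auto simp: orbit_of_eq_iff)
    then show "p \<in> {p \<in> \<Omega>. orbit_of \<Gamma> p \<in> orbit_of \<Gamma> ` U}"
      using u(2) by (metis (mono_tags, lifting) image_eqI mem_Collect_eq)
  qed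
  moreover have "open (\<Union>\<gamma>\<in>\<Gamma>. \<gamma> ` U)"
    by (intro open_UN ballI PSL3_open_image in_PSL3 assms)
  ultimately show ?thesis
    using assms(2) by (auto simp: openin_orbit_space openin_open_eq[OF open_domain])
qed

lemma topspace_orbit_space: "topspace X = orbit_of \<Gamma> ` \<Omega>"
proof
  show "topspace X \<subseteq> orbit_of \<Gamma> ` \<Omega>"
    using openin_orbit_space[of \<Gamma> \<Omega> "topspace X"] by blast
  show "orbit_of \<Gamma> ` \<Omega> \<subseteq> topspace X"
    using openin_subset[OF openin_orbit_image[OF open_domain]] by simp
qed

lemma orbit_chart:
  assumes g: "g \<in> carrier PSL3" and V: "open V" "(g \<circ> affine_pt) ` V \<subseteq> \<Omega>"
  defines "\<phi> \<equiv> orbit_of \<Gamma> \<circ> (g \<circ> affine_pt)"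
  shows "continuous_map (top_of_set V) X \<phi>" "open_map (top_of_set V) X \<phi>"
proof -
  let ?h = "g \<circ> affine_pt"
  show "continuous_map (top_of_set V) X \<phi>"
    unfolding continuous_map_def
  proof (intro conjI allI impI)
    show "\<phi> \<in> topspace (top_of_set V) \<rightarrow> topspace X"
      using V(2) by (auto simp: topspace_orbit_space \<phi>_def)
    fix T assume "openin X T"
    then have "open {p \<in> \<Omega>. orbit_of \<Gamma> p \<in> T}"
      by (simp add: openin_orbit_space openin_open_eq[OF open_domain])
    then have "openin (top_of_set V) (V \<inter> ?h -` {p \<in> \<Omega>. orbit_of \<Gamma> p \<in> T})"
      by (intro continuous_openin_preimage_gen PSL3_chart(1) g V(1))
    moreover have "V \<inter> ?h -` {p \<in> \<Omega>. orbit_of \<Gamma> p \<in> T} = {x \<in> topspace (top_of_set V). \<phi> x \<in> T}"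
      using V(2) by (auto simp: \<phi>_def)
    ultimately show "openin (top_of_set V) {x \<in> topspace (top_of_set V). \<phi> x \<in> T}"
      by simp
  qed
  show "open_map (top_of_set V) X \<phi>"
    unfolding open_map_def
  proof (intro allI impI)
    fix W assume "openin (top_of_set V) W"
    then have "open W" "W \<subseteq> V"
      using openin_open_eq[OF V(1)] by auto
    then have "openin X (orbit_of \<Gamma> ` (?h ` W))"
      using V(2) by (intro openin_orbit_image PSL3_chart(3) g) auto
    then show "openin X (\<phi> ` W)"
      by (simp add: \<phi>_def image_comp)
  qed
qed

text \<open>By properness only finitely many elements move a point of \<open>A\<close> into \<open>B\<close>; those that do not map
  \<open>p\<close> to \<open>q\<close> are excluded one after the other by shrinking the neighbourhoods. With \<open>p\<close> and \<open>q\<close>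
  in different orbits this yields the Hausdorff property, and with \<open>p = q\<close> an orbifold chart.\<close>

lemma separating_neighbourhoods:
  assumes p: "p \<in> \<Omega>" and q: "q \<in> \<Omega>"
  shows "\<exists>A B. open A \<and> open B \<and> p \<in> A \<and> q \<in> B \<and> A \<subseteq> \<Omega> \<and> B \<subseteq> \<Omega> \<and>
    (\<forall>\<gamma>\<in>\<Gamma>. \<gamma> ` A \<inter> B \<noteq> {} \<longrightarrow> \<gamma> p = q) \<and> finite {\<gamma> \<in> \<Gamma>. \<gamma> p = q}"
proof -
  obtain A B where AB: "open A" "open B" "p \<in> A" "q \<in> B"
    and fin: "finite {\<gamma> \<in> \<Gamma>. \<gamma> ` A \<inter> B \<noteq> {}}"
    using proper[OF p q] by blast
  define F where "F = {\<gamma> \<in> \<Gamma>. \<gamma> ` A \<inter> B \<noteq> {}}"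
  have "\<exists>P Q. open P \<and> open Q \<and> \<gamma> p \<in> P \<and> q \<in> Q \<and> (\<gamma> p \<noteq> q \<longrightarrow> P \<inter> Q = {})"
    if "\<gamma> \<in> \<Gamma>" for \<gamma>
  proof (cases "\<gamma> p = q")
    case True
    then show ?thesis
      by (intro exI[of _ UNIV]) auto
  next
    case False
    have "\<gamma> p \<in> range affine_pt" "q \<in> range affine_pt"
      using invariant[OF that p] q domain_affine by auto
    then show ?thesis
      using affine_pt_separation[OF _ _ False] by metis
  qed
  then obtain P Q where PQ: "\<And>\<gamma>. \<gamma> \<in> \<Gamma> \<Longrightarrow> open (P \<gamma>) \<and> open (Q \<gamma>) \<and> \<gamma> p \<in> P \<gamma> \<and> q \<in> Q \<gamma> \<and>
      (\<gamma> p \<noteq> q \<longrightarrow> P \<gamma> \<inter> Q \<gamma> = {})"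
    by metis
  define A' where "A' = A \<inter> \<Omega> \<inter> (\<Inter>\<gamma>\<in>F. \<gamma> -` P \<gamma>)"
  define B' where "B' = B \<inter> \<Omega> \<inter> (\<Inter>\<gamma>\<in>F. Q \<gamma>)"
  have F: "F \<subseteq> \<Gamma>" "finite F"
    using fin by (auto simp: F_def)
  have "open (\<gamma> -` P \<gamma>)" if "\<gamma> \<in> F" for \<gamma>
    using PQ F that PSL3_continuous in_PSL3 by (intro open_vimage) auto
  then have "open A'" "open B'"
    using PQ F AB open_domain unfolding A'_def B'_def by (auto intro!: open_Int open_INT)
  moreover have "p \<in> A'" "q \<in> B'" "A' \<subseteq> \<Omega>" "B' \<subseteq> \<Omega>"
    using PQ F AB p q unfolding A'_def B'_def by auto
  moreover have "\<gamma> p = q" if g: "\<gamma> \<in> \<Gamma>" "\<gamma> ` A' \<inter> B' \<noteq> {}" for \<gamma>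
  proof (rule ccontr)
    assume "\<gamma> p \<noteq> q"
    then have "P \<gamma> \<inter> Q \<gamma> = {}"
      using PQ[OF g(1)] by blast
    obtain x where x: "x \<in> A'" "\<gamma> x \<in> B'"
      using g(2) by blast
    then have "\<gamma> \<in> F"
      using g(1) by (auto simp: A'_def B'_def F_def)
    then show False
      using x \<open>P \<gamma> \<inter> Q \<gamma> = {}\<close> by (auto simp: A'_def B'_def)
  qed
  moreover have "finite {\<gamma> \<in> \<Gamma>. \<gamma> p = q}"
    by (rule finite_subset[OF _ fin]) (use AB in auto)
  ultimately show ?thesis
    by (intro exI[of _ A'] exI[of _ B']) auto
qed

lemma Hausdorff_orbit_space: "Hausdorff_space X"
  unfolding Hausdorff_space_def
proof (intro allI impI)
  fix x y assume xy: "x \<in> topspace X \<and> y \<in> topspace X \<and> x \<noteq> y"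
  then obtain p q where p: "p \<in> \<Omega>" "x = orbit_of \<Gamma> p" and q: "q \<in> \<Omega>" "y = orbit_of \<Gamma> q"
    by (auto simp: topspace_orbit_space)
  then have neq: "\<gamma> p \<noteq> q" if "\<gamma> \<in> \<Gamma>" for \<gamma>
    using xy that orbit_of_eq_iff by blast
  obtain A B where AB: "open A" "open B" "p \<in> A" "q \<in> B" "A \<subseteq> \<Omega>" "B \<subseteq> \<Omega>"
    "\<forall>\<gamma>\<in>\<Gamma>. \<gamma> ` A \<inter> B \<noteq> {} \<longrightarrow> \<gamma> p = q"
    using separating_neighbourhoods[OF p(1) q(1)] by (elim exE conjE)
  have "orbit_of \<Gamma> ` A \<inter> orbit_of \<Gamma> ` B = {}"
  proof (rule ccontr)
    assume "orbit_of \<Gamma> ` A \<inter> orbit_of \<Gamma> ` B \<noteq> {}"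
    then obtain a b where ab: "a \<in> A" "b \<in> B" "orbit_of \<Gamma> a = orbit_of \<Gamma> b"
      by blast
    then obtain \<gamma> where "\<gamma> \<in> \<Gamma>" "b = \<gamma> a"
      by (auto simp: orbit_of_eq_iff)
    then show False
      using AB(7) neq ab by blast
  qed
  then show "\<exists>U V. openin X U \<and> openin X V \<and> x \<in> U \<and> y \<in> V \<and> disjnt U V"
    using AB p q openin_orbit_image
    by (intro exI[of _ "orbit_of \<Gamma> ` A"] exI[of _ "orbit_of \<Gamma> ` B"]) (auto simp: disjnt_def)
qed

text \<open>The quotient is a continuous open image of an open subset of the affine chart.\<close>

lemma second_countable_orbit_space: "second_countable X"
proof (rule second_countable_open_map_image)
  let ?V = "affine_pt -` \<Omega>"
  have id: "id \<in> carrier PSL3"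
    by (rule in_PSL3[OF id_in])
  have V: "open ?V" "(id \<circ> affine_pt) ` ?V \<subseteq> \<Omega>"
    using continuous_affine_pt open_domain by (auto intro: open_vimage)
  show "continuous_map (top_of_set ?V) X (orbit_of \<Gamma> \<circ> (id \<circ> affine_pt))"
    "open_map (top_of_set ?V) X (orbit_of \<Gamma> \<circ> (id \<circ> affine_pt))"
    using orbit_chart[OF id V] by auto
  have "affine_pt ` ?V = \<Omega>"
    using domain_affine by auto
  then show "(orbit_of \<Gamma> \<circ> (id \<circ> affine_pt)) ` topspace (top_of_set ?V) = topspace X"
    unfolding topspace_orbit_space by (simp only: topspace_euclidean_subtopology id_comp flip: image_comp)
  show "second_countable (top_of_set ?V)"
    by (intro second_countable_subtopology second_countable_euclidean)
qed

lemma quotient_atlas_cases: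
  assumes "(V, G, \<phi>) \<in> quotient_atlas \<Gamma> \<Omega>"
  shows "\<exists>g h S. g \<in> carrier PSL3 \<and> h = g \<circ> affine_pt \<and> S = {\<gamma> \<in> \<Gamma>. \<gamma> ` h ` V = h ` V} \<and>
    open V \<and> h ` V \<subseteq> \<Omega> \<and> finite S \<and> (\<forall>\<gamma>\<in>\<Gamma> - S. \<gamma> ` h ` V \<inter> h ` V = {}) \<and>
    G = (\<lambda>\<gamma>. restrict (inv_into V h \<circ> \<gamma> \<circ> h) V) ` S \<and> \<phi> = orbit_of \<Gamma> \<circ> h"
  using assms unfolding quotient_atlas_def Let_def by auto

lemma stabiliser_in_chart:
  assumes "inj h" "\<gamma> ` h ` V = h ` V" "x \<in> V"
  shows "inv_into V h (\<gamma> (h x)) \<in> V" "h (inv_into V h (\<gamma> (h x))) = \<gamma> (h x)"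
proof -
  have "\<gamma> (h x) \<in> h ` V"
    using assms(2,3) by blast
  then show "inv_into V h (\<gamma> (h x)) \<in> V" "h (inv_into V h (\<gamma> (h x))) = \<gamma> (h x)"
    by (rule inv_into_into, rule f_inv_into_f)
qed

text \<open>A chart group consists of extensional functions; an element of it is determined by the property that
  \<open>h\<close> intertwines it with the corresponding element of the stabiliser. All group laws are transferred
  along \<open>h\<close> in this way.\<close>

lemma chart_group:
  fixes V :: "'c set"
  assumes h: "inj h"
  defines "S \<equiv> {\<gamma> \<in> \<Gamma>. \<gamma> ` h ` V = h ` V}"
  defines "k \<equiv> \<lambda>\<gamma>. restrict (inv_into V h \<circ> \<gamma> \<circ> h) V"
  shows "subgroup (k ` S) (BijGroup V)"
proof -
  have kV: "k \<gamma> x \<in> V" "h (k \<gamma> x) = \<gamma> (h x)" if "\<gamma> \<in> S" "x \<in> V" for \<gamma> x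
    using stabiliser_in_chart[OF h, of \<gamma> V x] that by (auto simp: k_def S_def)
  have id_S: "id \<in> S"
    using id_in by (simp add: S_def)
  have comp_S: "\<gamma> \<circ> \<delta> \<in> S" if "\<gamma> \<in> S" "\<delta> \<in> S" for \<gamma> \<delta>
  proof -
    have "(\<gamma> \<circ> \<delta>) ` h ` V = \<gamma> ` \<delta> ` h ` V"
      by (simp only: image_comp comp_assoc)
    then show ?thesis
      using that comp_in by (simp only: S_def mem_Collect_eq)
  qed
  have inv_S: "inv\<^bsub>PSL3\<^esub> \<gamma> \<in> S" if "\<gamma> \<in> S" for \<gamma>
  proof -
    have "\<gamma> \<in> \<Gamma>" "h ` V = \<gamma> ` h ` V"
      using that by (auto simp: S_def)
    then have "(inv\<^bsub>PSL3\<^esub> \<gamma>) ` h ` V = (inv\<^bsub>PSL3\<^esub> \<gamma>) ` \<gamma> ` h ` V"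
      by simp
    also have "\<dots> = h ` V"
      using \<open>\<gamma> \<in> \<Gamma>\<close> by (simp add: image_image)
    finally show ?thesis
      using inv_in[OF \<open>\<gamma> \<in> \<Gamma>\<close>] by (simp add: S_def)
  qed
  have ext: "f = k \<gamma>" if "f \<in> extensional V" "\<gamma> \<in> S" "\<And>x. x \<in> V \<Longrightarrow> f x \<in> V"
    "\<And>x. x \<in> V \<Longrightarrow> h (f x) = \<gamma> (h x)" for f \<gamma>
  proof (rule extensionalityI[OF that(1)])
    show "k \<gamma> \<in> extensional V"
      by (simp add: k_def)
    show "f x = k \<gamma> x" if "x \<in> V" for x
      using that kV \<open>\<gamma> \<in> S\<close> \<open>\<And>x. x \<in> V \<Longrightarrow> h (f x) = \<gamma> (h x)\<close> by (intro injD[OF h]) simp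
  qed
  have comp_k: "compose V (k \<gamma>) (k \<delta>) = k (\<gamma> \<circ> \<delta>)" if "\<gamma> \<in> S" "\<delta> \<in> S" for \<gamma> \<delta>
    using that kV comp_S by (intro ext) (auto simp: compose_def)
  have k_id: "k id = (\<lambda>x\<in>V. x)"
    using id_S by (intro ext[symmetric]) auto
  have Bij: "k \<gamma> \<in> Bij V" if "\<gamma> \<in> S" for \<gamma>
  proof -
    have "bij_betw (k \<gamma>) V V"
    proof (rule bij_betw_byWitness[where f' = "k (inv\<^bsub>PSL3\<^esub> \<gamma>)"])
      have "\<gamma> \<in> \<Gamma>"
        using that by (simp add: S_def)
      then show "\<forall>x\<in>V. k (inv\<^bsub>PSL3\<^esub> \<gamma>) (k \<gamma> x) = x" "\<forall>x\<in>V. k \<gamma> (k (inv\<^bsub>PSL3\<^esub> \<gamma>) x) = x"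
        using kV that inv_S[OF that] by (auto intro!: injD[OF h])
    qed (use kV that inv_S in auto)
    then show ?thesis
      by (simp add: Bij_def k_def)
  qed
  show ?thesis
  proof (rule group.subgroupI[OF group_BijGroup])
    show "k ` S \<subseteq> carrier (BijGroup V)"
      using Bij by (auto simp: BijGroup_def)
    show "k ` S \<noteq> {}"
      using id_S by blast
    fix a b assume a: "a \<in> k ` S" and b: "b \<in> k ` S"
    then show "a \<otimes>\<^bsub>BijGroup V\<^esub> b \<in> k ` S"
      using Bij comp_k comp_S by (auto simp: BijGroup_def)
    obtain \<gamma> where g: "\<gamma> \<in> S" "a = k \<gamma>"
      using a by blast
    then have "inv\<^bsub>PSL3\<^esub> \<gamma> \<circ> \<gamma> = id"
      by (auto simp: S_def in_PSL3 PSL3_inverse)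
    then have "inv\<^bsub>BijGroup V\<^esub> a = k (inv\<^bsub>PSL3\<^esub> \<gamma>)"
      using g Bij inv_S comp_k k_id
      by (intro group.inv_equality[OF group_BijGroup]) (auto simp: BijGroup_def)
    then show "inv\<^bsub>BijGroup V\<^esub> a \<in> k ` S"
      using inv_S g by blast
  qed
qed

text \<open>Read in two affine parametrisations, a group element becomes the projective transformation to
  which \<open>holomorphic_map_on_projective\<close> applies.\<close>

lemma conjugated_transition:
  assumes "g \<in> carrier PSL3" "g' \<in> carrier PSL3" "\<gamma> \<in> \<Gamma>"
    "g' (affine_pt y) = \<gamma> (g (affine_pt x))"
  shows "affine_pt y = (inv\<^bsub>PSL3\<^esub> g' \<circ> (\<gamma> \<circ> g)) (affine_pt x)"
  using assms(4) PSL3_inverse(4)[OF assms(2)] by (metis comp_apply)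

lemma orbifold_chart_quotient_atlas:
  assumes "C \<in> quotient_atlas \<Gamma> \<Omega>"
  shows "orbifold_chart X C"
proof -
  obtain V G \<phi> where C: "C = (V, G, \<phi>)"
    by (cases C)
  obtain g h S where g: "g \<in> carrier PSL3" and h: "h = g \<circ> affine_pt"
    and S: "S = {\<gamma> \<in> \<Gamma>. \<gamma> ` h ` V = h ` V}"
    and V: "open V" "h ` V \<subseteq> \<Omega>" and fin: "finite S"
    and disj: "\<forall>\<gamma>\<in>\<Gamma> - S. \<gamma> ` h ` V \<inter> h ` V = {}"
    and G: "G = (\<lambda>\<gamma>. restrict (inv_into V h \<circ> \<gamma> \<circ> h) V) ` S" and phi: "\<phi> = orbit_of \<Gamma> \<circ> h"
    using quotient_atlas_cases[OF assms[unfolded C]] by (elim exE conjE)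
  have inj: "inj h"
    unfolding h by (rule PSL3_chart(2)[OF g V(1)])
  have cont: "continuous_map (top_of_set V) X \<phi>" and op: "open_map (top_of_set V) X \<phi>"
    using orbit_chart[OF g V(1)] V(2) by (simp_all add: phi h)
  have sub: "subgroup G (BijGroup V)"
    unfolding G S by (rule chart_group[OF inj])
  have hol: "holomorphic_map_on f V" if fG: "f \<in> G" for f
  proof -
    obtain \<gamma> where gm: "f = restrict (inv_into V h \<circ> \<gamma> \<circ> h) V" "\<gamma> \<in> S"
      using fG unfolding G by (rule imageE)
    have "h (f x) = \<gamma> (h x)" if "x \<in> V" for x
      using stabiliser_in_chart[OF inj _ that, of \<gamma>] gm that by (simp add: S)
    moreover have gm_in: "\<gamma> \<in> \<Gamma>"
      using gm by (simp add: S)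
    ultimately have eq: "affine_pt (f x) = (inv\<^bsub>PSL3\<^esub> g \<circ> (\<gamma> \<circ> g)) (affine_pt x)" if "x \<in> V" for x
      using that by (intro conjugated_transition g) (simp_all add: h)
    have "inv\<^bsub>PSL3\<^esub> g \<circ> (\<gamma> \<circ> g) \<in> carrier PSL3"
      using in_PSL3[OF gm_in] by (intro PSL3_comp PSL3_inverse g)
    then show ?thesis
      using eq by (rule holomorphic_map_on_projective[OF V(1)])
  qed
  have open_phi: "openin X (\<phi> ` V)"
    using op by (simp add: open_map_def)
  have "quotient_map (top_of_set V) (subtopology X (\<phi> ` V)) \<phi>"
  proof (rule continuous_open_imp_quotient_map)
    show "continuous_map (top_of_set V) (subtopology X (\<phi> ` V)) \<phi>"
      using cont by (simp add: continuous_map_in_subtopology)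
    show "open_map (top_of_set V) (subtopology X (\<phi> ` V)) \<phi>"
      by (rule open_map_into_subtopology[OF op]) simp
    show "\<phi> ` topspace (top_of_set V) = topspace (subtopology X (\<phi> ` V))"
      using openin_subset[OF open_phi] by auto
  qed
  moreover have "\<phi> x = \<phi> y \<longleftrightarrow> (\<exists>f\<in>G. y = f x)" if xy: "x \<in> V" "y \<in> V" for x y
  proof
    assume "\<phi> x = \<phi> y"
    then obtain \<gamma> where gm: "\<gamma> \<in> \<Gamma>" "h y = \<gamma> (h x)"
      by (auto simp: phi orbit_of_eq_iff)
    then have "\<gamma> \<in> S"
      using disj xy by blast
    moreover have "inv_into V h (\<gamma> (h x)) = y"
      using gm(2) xy inj by (metis inj_on_subset inv_into_f_f subset_UNIV)
    ultimately show "\<exists>f\<in>G. y = f x"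
      using xy by (force simp: G)
  next
    assume "\<exists>f\<in>G. y = f x"
    then obtain \<gamma> where gm: "\<gamma> \<in> S" "y = inv_into V h (\<gamma> (h x))"
      using xy by (auto simp: G)
    then have "h y = \<gamma> (h x)"
      using stabiliser_in_chart[OF inj _ xy(1), of \<gamma>] by (simp add: S)
    then show "\<phi> x = \<phi> y"
      using gm by (auto simp: phi orbit_of_eq_iff S)
  qed
  ultimately show ?thesis
    using V(1) fin sub hol open_phi by (auto simp: orbifold_chart_def C G)
qed

text \<open>Points over the same orbit are related by some \<open>\<gamma>\<close> in the group; the local biholomorphism is \<open>\<gamma>\<close>
  read in the two charts, on the part of \<open>V\<close> that it sends into the image of \<open>V'\<close>.\<close>

lemma compatible_charts_quotient_atlas:
  assumes "C \<in> quotient_atlas \<Gamma> \<Omega>" "C' \<in> quotient_atlas \<Gamma> \<Omega>"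
  shows "compatible_charts C C'"
proof -
  obtain V G \<phi> V' G' \<phi>' where C: "C = (V, G, \<phi>)" "C' = (V', G', \<phi>')"
    by (cases C, cases C')
  obtain g h where g: "g \<in> carrier PSL3" and h: "h = g \<circ> affine_pt"
    and V: "open V" and phi: "\<phi> = orbit_of \<Gamma> \<circ> h"
    using quotient_atlas_cases[OF assms(1)[unfolded C]] by (elim exE conjE)
  obtain g' h' where g': "g' \<in> carrier PSL3" and h': "h' = g' \<circ> affine_pt"
    and V': "open V'" and phi': "\<phi>' = orbit_of \<Gamma> \<circ> h'"
    using quotient_atlas_cases[OF assms(2)[unfolded C]] by (elim exE conjE)
  note chart = PSL3_chart[OF g V, folded h] and chart' = PSL3_chart[OF g' V', folded h']
  have "\<exists>W W' f f'. open W \<and> x \<in> W \<and> W \<subseteq> V \<and> open W' \<and> y \<in> W' \<and> W' \<subseteq> V' \<and>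
      homeomorphism W W' f f' \<and> holomorphic_map_on f W \<and> holomorphic_map_on f' W' \<and>
      f x = y \<and> (\<forall>w\<in>W. \<phi>' (f w) = \<phi> w)"
    if xy: "x \<in> V" "y \<in> V'" "\<phi> x = \<phi>' y" for x y
  proof -
    obtain \<gamma> where gm: "\<gamma> \<in> \<Gamma>" "h' y = \<gamma> (h x)"
      using xy(3) by (auto simp: phi phi' orbit_of_eq_iff)
    have gm_PSL: "\<gamma> \<in> carrier PSL3"
      by (rule in_PSL3[OF gm(1)])
    define W where "W = V \<inter> (\<gamma> \<circ> h) -` h' ` V'"
    define W' where "W' = V' \<inter> (inv\<^bsub>PSL3\<^esub> \<gamma> \<circ> h') -` h ` V"
    define f where "f = inv_into V' h' \<circ> \<gamma> \<circ> h"
    define f' where "f' = inv_into V h \<circ> inv\<^bsub>PSL3\<^esub> \<gamma> \<circ> h'"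
    have f: "f w \<in> V'" "h' (f w) = \<gamma> (h w)" if "w \<in> W" for w
      using that by (auto simp: f_def W_def inv_into_into f_inv_into_f)
    have f': "f' w \<in> V" "h (f' w) = (inv\<^bsub>PSL3\<^esub> \<gamma>) (h' w)" if "w \<in> W'" for w
      using that by (auto simp: f'_def W'_def inv_into_into f_inv_into_f)
    have fW: "f w \<in> W'" "f' (f w) = w" if "w \<in> W" for w
    proof -
      show *: "f w \<in> W'"
        using f[OF that] gm(1) that by (auto simp: W'_def W_def)
      show "f' (f w) = w"
        using f'(2)[OF *] f(2)[OF that] gm(1) by (intro injD[OF chart(2)]) simp
    qed
    have fW': "f' w \<in> W" "f (f' w) = w" if "w \<in> W'" for w
    proof -
      show *: "f' w \<in> W"
        using f'[OF that] gm(1) that by (auto simp: W'_def W_def)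
      show "f (f' w) = w"
        using f(2)[OF *] f'(2)[OF that] gm(1) by (intro injD[OF chart'(2)]) simp
    qed
    have x: "x \<in> W"
      using xy(1,2) gm(2) by (simp add: W_def flip: gm(2))
    have "f x = y"
      using f(2)[OF x] gm(2) by (intro injD[OF chart'(2)]) simp
    have open_W: "open W" "open W'"
    proof -
      have "continuous_on V (\<gamma> \<circ> h)"
        by (intro continuous_on_compose chart PSL3_continuous gm_PSL)
      then show "open W"
        unfolding W_def Int_commute[of V] using V chart'(3) by (simp only: continuous_on_open_vimage)
      have "continuous_on V' (inv\<^bsub>PSL3\<^esub> \<gamma> \<circ> h')"
        by (intro continuous_on_compose chart' PSL3_continuous PSL3_inverse gm_PSL)
      then show "open W'"
        unfolding W'_def Int_commute[of V'] using V' chart(3)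
        by (simp only: continuous_on_open_vimage)
    qed
    have trans: "inv\<^bsub>PSL3\<^esub> g' \<circ> (\<gamma> \<circ> g) \<in> carrier PSL3"
      "inv\<^bsub>PSL3\<^esub> g \<circ> (inv\<^bsub>PSL3\<^esub> \<gamma> \<circ> g') \<in> carrier PSL3"
      by (intro PSL3_comp PSL3_inverse gm_PSL g g')+
    have eq: "affine_pt (f w) = (inv\<^bsub>PSL3\<^esub> g' \<circ> (\<gamma> \<circ> g)) (affine_pt w)" if "w \<in> W" for w
      using f(2)[OF that] by (intro conjugated_transition g g' gm(1)) (simp add: h h')
    have eq': "affine_pt (f' w) = (inv\<^bsub>PSL3\<^esub> g \<circ> (inv\<^bsub>PSL3\<^esub> \<gamma> \<circ> g')) (affine_pt w)" if "w \<in> W'" for w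
      using f'(2)[OF that] by (intro conjugated_transition g g' inv_in gm(1)) (simp add: h h')
    have "homeomorphism W W' f f'"
    proof (rule homeomorphismI)
      show "continuous_on W f" "continuous_on W' f'"
        using continuous_on_projective[OF trans(1) eq] continuous_on_projective[OF trans(2) eq'] by auto
    qed (use fW fW' in auto)
    moreover have "holomorphic_map_on f W" "holomorphic_map_on f' W'"
      using holomorphic_map_on_projective[OF open_W(1) trans(1) eq]
        holomorphic_map_on_projective[OF open_W(2) trans(2) eq'] by auto
    moreover have "\<phi>' (f w) = \<phi> w" if "w \<in> W" for w
    proof -
      have "orbit_of \<Gamma> (h w) = orbit_of \<Gamma> (h' (f w))"
        using f(2)[OF that] gm(1) by (auto simp: orbit_of_eq_iff)
      then show ?thesis
        by (simp add: phi phi')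
    qed
    moreover have "y \<in> W'" "W \<subseteq> V" "W' \<subseteq> V'"
      using fW(1)[OF x] \<open>f x = y\<close> by (auto simp: W_def W'_def)
    ultimately show ?thesis
      using open_W x \<open>f x = y\<close> by blast
  qed
  then show ?thesis
    by (simp add: compatible_charts_def C)
qed

text \<open>Intersecting the preimages of a small neighbourhood under the finitely many elements that fix \<open>p\<close>
  gives a neighbourhood which they preserve and which all other elements move off itself.\<close>

lemma quotient_atlas_covers:
  assumes p: "p \<in> \<Omega>"
  shows "\<exists>V G \<phi>. (V, G, \<phi>) \<in> quotient_atlas \<Gamma> \<Omega> \<and> orbit_of \<Gamma> p \<in> \<phi> ` V"
proof -
  obtain A B where AB: "open A" "open B" "p \<in> A" "p \<in> B" "A \<subseteq> \<Omega>" "B \<subseteq> \<Omega>"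
    "\<forall>\<gamma>\<in>\<Gamma>. \<gamma> ` A \<inter> B \<noteq> {} \<longrightarrow> \<gamma> p = p" and fin: "finite {\<gamma> \<in> \<Gamma>. \<gamma> p = p}"
    using separating_neighbourhoods[OF p p] by (elim exE conjE)
  define S where "S = {\<gamma> \<in> \<Gamma>. \<gamma> p = p}"
  define U where "U = (\<Inter>s\<in>S. s -` (A \<inter> B))"
  have "open (s -` (A \<inter> B))" if "s \<in> S" for s
    using that AB by (intro open_vimage open_Int PSL3_continuous in_PSL3) (auto simp: S_def)
  then have "open U"
    using fin by (auto simp: U_def S_def)
  have "id \<in> S"
    using id_in by (simp add: S_def)
  then have "U \<subseteq> id -` (A \<inter> B)"
    unfolding U_def by blast
  then have U: "U \<subseteq> A" "U \<subseteq> B" "p \<in> U"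
    using AB by (auto simp: U_def S_def)
  have sub: "s ` U \<subseteq> U" if "s \<in> S" for s
  proof clarify
    fix u assume "u \<in> U"
    have "t \<circ> s \<in> S" if "t \<in> S" for t
      using that \<open>s \<in> S\<close> comp_in by (simp add: S_def)
    then show "s u \<in> U"
      using \<open>u \<in> U\<close> by (fastforce simp: U_def)
  qed
  have stab: "s ` U = U" if s: "s \<in> S" for s
  proof
    have "s \<in> \<Gamma>" "s p = p"
      using s by (auto simp: S_def)
    moreover from this have "(inv\<^bsub>PSL3\<^esub> s) (s p) = p"
      by (intro inv_apply)
    ultimately have "inv\<^bsub>PSL3\<^esub> s \<in> S"
      using inv_in[OF \<open>s \<in> \<Gamma>\<close>] \<open>s p = p\<close> by (simp add: S_def)
    show "U \<subseteq> s ` U"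
    proof
      fix u assume "u \<in> U"
      then have "(inv\<^bsub>PSL3\<^esub> s) u \<in> U"
        using sub[OF \<open>inv\<^bsub>PSL3\<^esub> s \<in> S\<close>] by blast
      moreover have "s ((inv\<^bsub>PSL3\<^esub> s) u) = u"
        using \<open>s \<in> \<Gamma>\<close> by simp
      ultimately show "u \<in> s ` U"
        by (metis imageI)
    qed
  qed (rule sub[OF s])
  have meets: "\<gamma> \<in> S" if "\<gamma> \<in> \<Gamma>" "\<gamma> ` U \<inter> U \<noteq> {}" for \<gamma>
  proof -
    have "\<gamma> ` A \<inter> B \<noteq> {}"
      using that(2) U by blast
    then show ?thesis
      using AB(7) that(1) by (simp add: S_def)
  qed
  have S_eq: "{\<gamma> \<in> \<Gamma>. \<gamma> ` U = U} = S"
  proof (intro equalityI subsetI)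
    fix \<gamma> assume "\<gamma> \<in> {\<gamma> \<in> \<Gamma>. \<gamma> ` U = U}"
    then have "\<gamma> \<in> \<Gamma>" "\<gamma> ` U \<inter> U \<noteq> {}"
      using U(3) by auto
    then show "\<gamma> \<in> S"
      by (rule meets)
  next
    fix \<gamma> assume "\<gamma> \<in> S"
    then show "\<gamma> \<in> {\<gamma> \<in> \<Gamma>. \<gamma> ` U = U}"
      using stab by (simp add: S_def)
  qed
  define V where "V = affine_pt -` U"
  define h where "h = id \<circ> affine_pt"
  have hV: "h ` V = U"
    using U(1) AB(5) domain_affine by (auto simp: h_def V_def)
  have "open V"
    unfolding V_def by (intro open_vimage \<open>open U\<close> continuous_affine_pt)
  moreover have "\<forall>\<gamma>\<in>\<Gamma> - S. \<gamma> ` U \<inter> U = {}"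
    using meets by blast
  ultimately have "(V, (\<lambda>\<gamma>. restrict (inv_into V h \<circ> \<gamma> \<circ> h) V) ` S, orbit_of \<Gamma> \<circ> h)
      \<in> quotient_atlas \<Gamma> \<Omega>"
    unfolding quotient_atlas_def Let_def mem_Collect_eq prod.case
    by (intro bexI[of _ id] in_PSL3[OF id_in], unfold h_def[symmetric] hV S_eq)
       (use fin U(1) AB(5) in \<open>auto simp: S_def\<close>)
  moreover have "orbit_of \<Gamma> p \<in> (orbit_of \<Gamma> \<circ> h) ` V"
    unfolding image_comp[symmetric] hV using U(3) by (rule imageI)
  ultimately show ?thesis
    by blast
qed

theorem complex_orbifold_orbit_space: "complex_orbifold X (quotient_atlas \<Gamma> \<Omega>)"
proof -
  have "(\<Union>(V, G, \<phi>)\<in>quotient_atlas \<Gamma> \<Omega>. \<phi> ` V) = topspace X"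
  proof (intro equalityI subsetI)
    fix y assume "y \<in> (\<Union>(V, G, \<phi>)\<in>quotient_atlas \<Gamma> \<Omega>. \<phi> ` V)"
    then obtain V G \<phi> where "(V, G, \<phi>) \<in> quotient_atlas \<Gamma> \<Omega>" "y \<in> \<phi> ` V"
      by auto
    then show "y \<in> topspace X"
      using orbifold_chart_quotient_atlas[of "(V, G, \<phi>)"] openin_subset[of X "\<phi> ` V"]
      by (auto simp: orbifold_chart_def)
  next
    fix y assume "y \<in> topspace X"
    then obtain p where "p \<in> \<Omega>" "y = orbit_of \<Gamma> p"
      by (auto simp: topspace_orbit_space)
    then show "y \<in> (\<Union>(V, G, \<phi>)\<in>quotient_atlas \<Gamma> \<Omega>. \<phi> ` V)"
      using quotient_atlas_covers[of p] by force
  qed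
  then show ?thesis
    unfolding complex_orbifold_def
    using Hausdorff_orbit_space second_countable_orbit_space orbifold_chart_quotient_atlas
      compatible_charts_quotient_atlas by blast
qed

end

section \<open>The quotient of the torus\<close>

lemma lattice_group_inverse: "lattice_group (inverse l) = lattice_group l"
proof -
  have "lattice_group (inverse l) \<subseteq> lattice_group l" for l
  proof
    fix g assume "g \<in> lattice_group (inverse l)"
    then obtain m n r where "g = tor (inverse l powi m) (inverse l powi n) \<circ> cyc ^^ r"
      by (rule lattice_group_cases)
    then have "g = tor (l powi (- m)) (l powi (- n)) \<circ> cyc ^^ r"
      by (simp add: power_int_minus power_int_inverse)
    then show "g \<in> lattice_group l"
      using lattice_groupI by simp
  qed
  from this[of l] this[of "inverse l"] show ?thesis
    by auto
qed

lemma torus_subset_affine: "torus \<subseteq> range affine_pt"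
  by (auto simp: torus_def range_affine_pt)

lemma proper_action_lattice_group:
  assumes l: "l \<noteq> 0" "cmod l \<noteq> 1"
  shows "proper_action (lattice_group l) torus"
proof (rule proper_action.intro)
  show "subgroup (lattice_group l) PSL3"
    by (rule subgroup_lattice_group[OF l(1)])
  show "open torus"
    by (rule open_torus)
  show "torus \<subseteq> range affine_pt"
    by (rule torus_subset_affine)
  show "g p \<in> torus" if "g \<in> lattice_group l" "p \<in> torus" for g p
    by (rule lattice_group_torus[OF l(1) that])
  fix p q assume pq: "p \<in> torus" "q \<in> torus"
  define C where "C = max (log_spread p) (log_spread q) + 1"
  define A where "A = log_spread -` {..<C} \<inter> torus"
  have "open A"
    using continuous_log_spread unfolding A_def by (simp only: continuous_on_open_vimage open_torus open_lessThan)
  moreover have "p \<in> A" "q \<in> A"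
    using pq by (auto simp: A_def C_def)
  moreover have "finite {g \<in> lattice_group l. g ` A \<inter> A \<noteq> {}}"
  proof (rule finite_subset[OF subsetI finite_bounded_log_spread[OF l, of C]])
    fix g assume "g \<in> {g \<in> lattice_group l. g ` A \<inter> A \<noteq> {}}"
    then obtain r where "g \<in> lattice_group l" "r \<in> A" "g r \<in> A"
      by blast
    then show "g \<in> {g \<in> lattice_group l. \<exists>p\<in>torus. log_spread p \<le> C \<and> log_spread (g p) \<le> C}"
      by (auto simp: A_def intro!: bexI[of _ r])
  qed
  ultimately show "\<exists>A B. open A \<and> open B \<and> p \<in> A \<and> q \<in> B \<and>
      finite {\<gamma> \<in> lattice_group l. \<gamma> ` A \<inter> B \<noteq> {}}"
    by blast
qed

text \<open>Multiplication by \<open>c\<close> translates the logarithm by \<open>ln c\<close>, so some power brings it into the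
  interval from \<open>ln c\<close> to \<open>0\<close>; rounding up the quotient below finds the power.\<close>

lemma power_int_into_annulus:
  assumes "0 < (c :: real)" "c < 1" "0 < r"
  obtains m :: int where "c \<le> c powi m * r" "c powi m * r \<le> 1"
proof -
  define m where "m = \<lceil>- ln r / ln c\<rceil>"
  have "ln c < 0"
    using assms by simp
  have "- ln r / ln c \<le> of_int m" "of_int m < - ln r / ln c + 1"
    unfolding m_def by linarith+
  then have *: "of_int m * ln c + ln r \<le> 0" "ln c \<le> of_int m * ln c + ln r"
    using \<open>ln c < 0\<close> by (simp_all add: field_simps)
  have "ln (c powi m * r) = of_int m * ln c + ln r"
    using assms ln_cmod_power_int[of "of_real c" m] by (simp add: ln_mult norm_power_int)
  moreover have "0 < c powi m * r"
    using assms by simp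
  ultimately have "c \<le> c powi m * r" "c powi m * r \<le> 1"
    using * assms by (metis ln_le_cancel_iff, metis ln_le_zero_iff)
  then show ?thesis
    by (rule that)
qed

lemma compact_annulus_product: "compact {x :: complex^2. \<forall>i. c \<le> cmod (x $ i) \<and> cmod (x $ i) \<le> 1}"
    (is "compact ?D")
proof (rule compact_eq_bounded_closed[THEN iffD2, OF conjI])
  have "norm x \<le> 2" if "x \<in> ?D" for x
  proof -
    have "norm x \<le> (\<Sum>i\<in>UNIV. cmod (x $ i))"
      unfolding norm_vec_def by (rule L2_set_le_sum) simp
    also have "\<dots> \<le> 2"
      using that by (simp add: sum_2) (metis add_mono one_add_one)
    finally show ?thesis .
  qed
  then show "bounded ?D"
    by (rule boundedI)
  have "?D = (\<Inter>i. {x. c \<le> cmod (x $ i)} \<inter> {x. cmod (x $ i) \<le> 1})"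
    by auto
  also have "closed \<dots>"
    by (intro closed_INT ballI closed_Int closed_Collect_le continuous_intros)
  finally show "closed ?D" .
qed

text \<open>The points with both affine coordinates in the closed annulus between the radii \<open>cmod l\<close> and 1
  form a compact set, and the lattice moves every point of the torus into it.\<close>

lemma compact_orbit_space:
  assumes l: "l \<noteq> 0" "cmod l < 1"
  shows "compact_space (orbit_space (lattice_group l) torus)"
proof -
  interpret proper_action "lattice_group l" torus
    using proper_action_lattice_group l by simp
  let ?V = "affine_pt -` torus"
  let ?f = "orbit_of (lattice_group l) \<circ> (id \<circ> affine_pt)"
  define D where "D = {x :: complex^2. \<forall>i. cmod l \<le> cmod (x $ i) \<and> cmod (x $ i) \<le> 1}"
  have V: "open ?V" "(id \<circ> affine_pt) ` ?V \<subseteq> torus"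
    using open_torus by (auto intro: open_vimage continuous_affine_pt)
  have "D \<subseteq> ?V"
  proof
    fix x assume "x \<in> D"
    then have "x $ i \<noteq> 0" for i
      using l by (auto simp: D_def dest: spec[of _ i])
    then show "x \<in> ?V"
      by (simp add: affine_pt_def proj_in_torus_iff affine_vec_nonzero)
  qed
  moreover have "compact D"
    unfolding D_def by (rule compact_annulus_product)
  ultimately have "compactin (top_of_set ?V) D"
    by (simp add: compactin_subtopology)
  moreover have "continuous_map (top_of_set ?V) X ?f"
    by (rule orbit_chart(1)[OF in_PSL3[OF id_in] V])
  ultimately have "compactin X (?f ` D)"
    by (rule image_compactin)
  moreover have "topspace X \<subseteq> ?f ` D"
  proof
    fix y assume "y \<in> topspace X"
    then obtain p where p: "p \<in> torus" "y = orbit_of (lattice_group l) p"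
      by (auto simp: topspace_orbit_space)
    obtain v where v: "v \<noteq> 0" "v $ 1 \<noteq> 0" "v $ 2 \<noteq> 0" "v $ 3 \<noteq> 0" "p = proj v"
      by (rule torus_cases[OF p(1)])
    obtain m where m: "cmod l \<le> cmod l powi m * cmod (v $ 1 / v $ 3)"
      "cmod l powi m * cmod (v $ 1 / v $ 3) \<le> 1"
      using power_int_into_annulus[of "cmod l" "cmod (v $ 1 / v $ 3)"] l v by auto
    obtain n where n: "cmod l \<le> cmod l powi n * cmod (v $ 2 / v $ 3)"
      "cmod l powi n * cmod (v $ 2 / v $ 3) \<le> 1"
      using power_int_into_annulus[of "cmod l" "cmod (v $ 2 / v $ 3)"] l v by auto
    define x where "x = (vector [l powi m * (v $ 1 / v $ 3), l powi n * (v $ 2 / v $ 3)] :: complex^2)"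
    have "x \<in> D"
      using m n by (simp add: D_def x_def forall_2 norm_mult norm_divide norm_power_int)
    have nz: "vector [l powi m * v $ 1, l powi n * v $ 2, v $ 3] \<noteq> (0 :: complex^3)"
      using v by (simp add: zero_vec3_iff)
    have "(vector [x $ 1, x $ 2, 1] :: complex^3) =
        (1 / v $ 3) *s vector [l powi m * v $ 1, l powi n * v $ 2, v $ 3]"
      using v by (simp add: vec_eq_iff forall_3 x_def)
    then have "affine_pt x = tor (l powi m) (l powi n) p"
      using proj_scale[OF _ nz, of "1 / v $ 3"] v l by (simp add: affine_pt_def tor_proj)
    then have "orbit_of (lattice_group l) p = ?f x"
      using tor_in_lattice_group[of l m n] by (auto simp: orbit_of_eq_iff)
    then show "y \<in> ?f ` D"
      using p(2) \<open>x \<in> D\<close> by blast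
  qed
  ultimately show ?thesis
    by (metis compactin_subset_topspace compact_space_def subset_antisym)
qed

lemma axis_3_eq:
  "axis 1 1 = (vector [1, 0, 0] :: complex^3)" "axis 2 1 = (vector [0, 1, 0] :: complex^3)"
  "axis 3 1 = (vector [0, 0, 1] :: complex^3)"
  by (simp_all add: vec_eq_iff forall_3 axis_def)

lemma basis_pt_eq:
  "basis_pt 1 = proj (vector [1, 0, 0])" "basis_pt 2 = proj (vector [0, 1, 0])"
  "basis_pt 3 = proj (vector [0, 0, 1])"
  by (simp_all add: basis_pt_def axis_3_eq)

lemma basis_vec_nonzero:
  "(vector [1, 0, 0] :: complex^3) \<noteq> 0" "(vector [0, 1, 0] :: complex^3) \<noteq> 0"
  "(vector [0, 0, 1] :: complex^3) \<noteq> 0"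
  by (simp_all add: zero_vec3_iff)

lemma basis_pt_distinct: "basis_pt 1 \<noteq> basis_pt 2"
  by (simp add: basis_pt_eq proj_eq_iff basis_vec_nonzero vec_eq_iff forall_3)

lemma coords_basis_pt_3: "coords (basis_pt 1) $ 3 = 0" "coords (basis_pt 2) $ 3 = 0"
  "coords (basis_pt 3) $ 3 \<noteq> 0"
  by (simp_all add: basis_pt_eq coords_proj_zero_iff basis_vec_nonzero)

lemma cyc_basis_pt: "cyc (basis_pt 1) = basis_pt 2" "cyc (basis_pt 3) = basis_pt 1"
  by (simp_all add: basis_pt_eq cyc_proj basis_vec_nonzero)

lemma singular_locus_nonempty: "singular_locus (lattice_group l) torus \<noteq> {}"
proof -
  define p where "p = proj (vector [1, 1, 1])"
  have "p \<in> torus" "cyc p = p"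
    by (simp_all add: p_def proj_in_torus_iff cyc_proj affine_vec_nonzero)
  moreover have "cyc \<noteq> id"
    using cyc_basis_pt(1) basis_pt_distinct by auto
  ultimately show ?thesis
    using cyc_in_lattice_group[of l] by (auto simp: singular_locus_def isotropy_def)
qed

section \<open>An affine subgroup of finite index\<close>

definition diagonal_group :: "complex \<Rightarrow> (cp2 \<Rightarrow> cp2) set" where
  "diagonal_group l = {tor (l powi m) (l powi n) | m n. True}"

lemma tor_affine:
  assumes "x \<noteq> 0" "y \<noteq> 0"
  shows "tor x y ` range affine_pt = range affine_pt"
proof -
  have sub: "tor x y ` range affine_pt \<subseteq> range affine_pt" if "x \<noteq> 0" "y \<noteq> 0" for x y
  proof
    fix q assume "q \<in> tor x y ` range affine_pt"
    then obtain p where p: "p \<in> range affine_pt" "q = tor x y p"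
      by blast
    obtain v where v: "v \<noteq> 0" "p = proj v"
      by (rule cp2_cases)
    have "v $ 3 \<noteq> 0"
      using p(1) v by (simp add: range_affine_pt coords_proj_zero_iff)
    moreover from this have "vector [x * v $ 1, y * v $ 2, v $ 3] \<noteq> (0 :: complex^3)"
      by (simp add: zero_vec3_iff)
    ultimately show "q \<in> range affine_pt"
      using that by (simp add: p v tor_proj range_affine_pt coords_proj_zero_iff)
  qed
  have "p \<in> tor x y ` range affine_pt" if "p \<in> range affine_pt" for p
  proof
    show "p = tor x y (tor (1 / x) (1 / y) p)"
      using assms by (simp add: tor_tor tor_1)
    show "tor (1 / x) (1 / y) p \<in> range affine_pt"
      using sub[of "1 / x" "1 / y"] assms that by auto
  qed
  then show ?thesis
    using sub[OF assms] by blast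
qed

lemma subgroup_diagonal_group:
  assumes l: "l \<noteq> 0"
  shows "subgroup (diagonal_group l) PSL3"
proof (rule group.subgroupI[OF group_PSL3])
  show sub: "diagonal_group l \<subseteq> carrier PSL3"
    using l by (auto simp: diagonal_group_def tor_in_PSL3)
  show "diagonal_group l \<noteq> {}"
    by (auto simp: diagonal_group_def)
  fix g h assume g: "g \<in> diagonal_group l" and h: "h \<in> diagonal_group l"
  obtain m n where g': "g = tor (l powi m) (l powi n)"
    using g by (auto simp: diagonal_group_def)
  obtain m' n' where h': "h = tor (l powi m') (l powi n')"
    using h by (auto simp: diagonal_group_def)
  have "g \<circ> h = tor (l powi (m + m')) (l powi (n + n'))"
    using l by (auto simp: fun_eq_iff g' h' tor_tor power_int_add)
  then show "g \<otimes>\<^bsub>PSL3\<^esub> h \<in> diagonal_group l"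
    by (auto simp: PSL3_simps diagonal_group_def)
  define k where "k = tor (l powi (- m)) (l powi (- n))"
  have "k \<in> carrier PSL3"
    unfolding k_def using l by (intro tor_in_PSL3) simp_all
  moreover have "k \<circ> g = id"
    using l by (auto simp: fun_eq_iff g' k_def tor_tor tor_1 power_int_minus)
  ultimately have "inv\<^bsub>PSL3\<^esub> g = k"
    using PSL3_inverse_eq sub g by blast
  then show "inv\<^bsub>PSL3\<^esub> g \<in> diagonal_group l"
    by (auto simp: k_def diagonal_group_def)
qed

lemma affine_diagonal_group:
  assumes l: "l \<noteq> 0"
  shows "affine_group (diagonal_group l)"
proof -
  have "\<one>\<^bsub>PSL3\<^esub> \<in> carrier PSL3" "inv\<^bsub>PSL3\<^esub> \<one>\<^bsub>PSL3\<^esub> = \<one>\<^bsub>PSL3\<^esub>"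
    using group.is_monoid[OF group_PSL3] by (auto simp: monoid.inv_one)
  then have "id \<in> carrier PSL3" "inv\<^bsub>PSL3\<^esub> id = id"
    by (simp_all only: PSL3_simps)
  moreover have "g \<in> carrier PSL3 \<and> g ` range affine_pt = range affine_pt"
    if g: "g \<in> diagonal_group l" for g
  proof -
    obtain m n where "g = tor (l powi m) (l powi n)"
      using g by (auto simp: diagonal_group_def)
    then show ?thesis
      using l by (simp add: tor_in_PSL3 tor_affine del: image_eqI)
  qed
  ultimately have "conjugate_into (diagonal_group l)
      {g \<in> carrier PSL3. g ` range affine_pt = range affine_pt}"
    unfolding conjugate_into_def by (intro bexI[of _ id]) (simp_all only: PSL3_simps id_comp comp_id mem_Collect_eq, blast)
  then show ?thesis
    using subgroup_diagonal_group[OF l] by (simp add: affine_group_def)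
qed

text \<open>Diagonal factors are absorbed by the diagonal subgroup, so the cosets are represented by powers of
  the permutation.\<close>

lemma virtually_affine_lattice_group:
  assumes l: "l \<noteq> 0"
  shows "virtually_affine (lattice_group l)"
proof -
  let ?G = "PSL3\<lparr>carrier := lattice_group l\<rparr>"
  let ?H = "diagonal_group l"
  have coset: "?H #>\<^bsub>?G\<^esub> g = (\<lambda>h. h \<circ> g) ` ?H" for g
    by (auto simp: r_coset_def PSL3_simps)
  have "?H #>\<^bsub>?G\<^esub> g \<in> (\<lambda>r. ?H #>\<^bsub>?G\<^esub> (cyc ^^ r)) ` {..<3}" if g: "g \<in> lattice_group l" for g
  proof -
    obtain m n r where r: "r < 3" "g = tor (l powi m) (l powi n) \<circ> cyc ^^ r"
      by (rule lattice_group_cases[OF g])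
    have shift: "tor (l powi i) (l powi j) \<circ> g = tor (l powi (i + m)) (l powi (j + n)) \<circ> cyc ^^ r" for i j
      using l by (auto simp: r(2) fun_eq_iff tor_tor power_int_add)
    have "(\<lambda>h. h \<circ> g) ` ?H = (\<lambda>h. h \<circ> cyc ^^ r) ` ?H"
    proof (intro equalityI subsetI)
      fix f assume "f \<in> (\<lambda>h. h \<circ> g) ` ?H"
      then obtain i j where "f = tor (l powi i) (l powi j) \<circ> g"
        by (auto simp: diagonal_group_def)
      then show "f \<in> (\<lambda>h. h \<circ> cyc ^^ r) ` ?H"
        unfolding shift diagonal_group_def by blast
    next
      fix f assume "f \<in> (\<lambda>h. h \<circ> cyc ^^ r) ` ?H"
      then obtain i j where "f = tor (l powi i) (l powi j) \<circ> cyc ^^ r"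
        by (auto simp: diagonal_group_def)
      then have "f = tor (l powi (i - m)) (l powi (j - n)) \<circ> g"
        by (simp add: shift)
      then show "f \<in> (\<lambda>h. h \<circ> g) ` ?H"
        unfolding diagonal_group_def by blast
    qed
    then show ?thesis
      unfolding coset using r(1) by blast
  qed
  then have "rcosets\<^bsub>?G\<^esub> ?H \<subseteq> (\<lambda>r. ?H #>\<^bsub>?G\<^esub> (cyc ^^ r)) ` {..<3}"
    by (auto simp: RCOSETS_def)
  then have "finite (rcosets\<^bsub>?G\<^esub> ?H)"
    by (rule finite_subset) simp
  moreover have "?H \<subseteq> lattice_group l"
    by (auto simp: diagonal_group_def tor_in_lattice_group)
  ultimately show ?thesis
    using subgroup_lattice_group[OF l] affine_diagonal_group[OF l] by (auto simp: virtually_affine_def)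
qed

section \<open>Topological conjugates of a homology\<close>

lemma proj_neq_independent:
  assumes "proj v \<noteq> proj w" "v \<noteq> 0" "w \<noteq> 0" "x *s v + y *s w = 0"
  shows "x = 0 \<and> y = 0"
proof -
  have "x = 0"
  proof (rule ccontr)
    assume "x \<noteq> 0"
    have "x *s v = (- y) *s w"
      using assms(4) by (simp add: add_eq_0_iff2)
    moreover from this have "y \<noteq> 0"
      using \<open>x \<noteq> 0\<close> assms(2) by auto
    ultimately show False
      using proj_scale[OF \<open>x \<noteq> 0\<close> assms(2)] proj_scale[of "- y", OF _ assms(3)] assms(1) by simp
  qed
  then show ?thesis
    using assms(3,4) by simp
qed

text \<open>The rows of \<open>Q\<close> are the coordinate functionals of the basis \<open>u, v, w\<close>.\<close>

lemma dual_basis: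
  fixes u v w :: "complex^3"
  assumes indep: "\<forall>x y z. x *s u + y *s v + z *s w = 0 \<longrightarrow> x = 0 \<and> y = 0 \<and> z = 0"
  shows "\<exists>Q :: complex^3^3. (\<forall>x y z. Q *v (x *s u + y *s v + z *s w) = vector [x, y, z]) \<and>
    (\<forall>t. t = (Q *v t) $ 1 *s u + (Q *v t) $ 2 *s v + (Q *v t) $ 3 *s w)"
proof -
  define P :: "complex^3^3" where "P = (\<chi> i j. if j = 1 then u $ i else if j = 2 then v $ i else w $ i)"
  have P: "P *v c = c $ 1 *s u + c $ 2 *s v + c $ 3 *s w" for c
    by (simp add: P_def vec_eq_iff matrix_vector_mult_def sum_3 mult.commute)
  have "c = 0" if "P *v c = 0" for c
    using indep[rule_format, of "c $ 1" "c $ 2" "c $ 3"] that by (simp add: P zero_vec3_iff)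
  then obtain Q where Q: "Q ** P = mat 1"
    using matrix_left_invertible_ker[of P] by blast
  then have "P ** Q = mat 1"
    by (simp add: matrix_left_right_inverse)
  then have "t = P *v (Q *v t)" for t
    by (simp add: matrix_vector_mul_assoc)
  then have 2: "t = (Q *v t) $ 1 *s u + (Q *v t) $ 2 *s v + (Q *v t) $ 3 *s w" for t
    unfolding P .
  have 1: "Q *v (x *s u + y *s v + z *s w) = vector [x, y, z]" for x y z
  proof -
    have "x *s u + y *s v + z *s w = P *v vector [x, y, z]"
      by (simp add: P)
    then show ?thesis
      using Q by (simp add: matrix_vector_mul_assoc)
  qed
  show ?thesis
    using 1 2 by blast
qed

text \<open>Applying \<open>N - m\<close> to a linear relation kills the first two terms, so the third coefficient vanishes.\<close>

lemma eigenvectors_independent: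
  fixes N :: "complex^3^3"
  assumes "N *v u = m *s u" "N *v v = m *s v" "N *v w = n *s w" "m \<noteq> n" "w \<noteq> 0"
    "proj u \<noteq> proj v" "u \<noteq> 0" "v \<noteq> 0" and sum: "x *s u + y *s v + z *s w = 0"
  shows "x = 0 \<and> y = 0 \<and> z = 0"
proof -
  have "0 = N *v (x *s u + y *s v + z *s w) - m *s (x *s u + y *s v + z *s w)"
    by (simp add: sum)
  also have "\<dots> = ((n - m) * z) *s w"
    using assms(1-3) by (simp add: matrix_vector_right_distrib vector_scalar_commute vec_eq_iff algebra_simps)
  finally have "z = 0"
    using assms(4,5) by simp
  then show ?thesis
    using proj_neq_independent[OF assms(6-8)] sum by simp
qed

text \<open>The eigenvalues are roots of the characteristic polynomial, here written out for a matrix of size 3.\<close>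

lemma finite_eigenvalues: "finite {m. \<exists>v. v \<noteq> 0 \<and> (N :: complex^3^3) *v v = m *s v}"
proof (rule finite_subset)
  let ?a = "\<lambda>i j. N $ i $ j"
  define p where "p = [: det N,
    - (?a 1 1 * ?a 2 2 - ?a 1 2 * ?a 2 1 + ?a 1 1 * ?a 3 3 - ?a 1 3 * ?a 3 1
      + ?a 2 2 * ?a 3 3 - ?a 2 3 * ?a 3 2), ?a 1 1 + ?a 2 2 + ?a 3 3, - 1 :]"
  show "{m. \<exists>v. v \<noteq> 0 \<and> N *v v = m *s v} \<subseteq> {m. poly p m = 0}"
  proof clarify
    fix m v assume v: "v \<noteq> 0" "N *v v = m *s v"
    define A where "A = (\<chi> i j. ?a i j - (if i = j then m else 0))"
    have "A *v v = N *v v - m *s v"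
      by (simp add: A_def vec_eq_iff forall_3 matrix_vector_mult_def sum_3 algebra_simps)
    then have "det A = 0"
      using v matrix_mult_nonzero[of A v] by auto
    moreover have "det A = poly p m"
      by (simp add: A_def p_def det_3 algebra_simps)
    ultimately show "poly p m = 0"
      by simp
  qed
  show "finite {m. poly p m = 0}"
    by (rule poly_roots_finite) (simp add: p_def)
qed

lemma proj_map_fixed_iff:
  assumes "det N \<noteq> 0"
  shows "proj_map N p = p \<longleftrightarrow> (\<exists>m. N *v coords p = m *s coords p)"
proof -
  have nz: "N *v coords p \<noteq> 0"
    by (rule matrix_mult_nonzero[OF assms coords_nonzero])
  have "proj_map N p = p \<longleftrightarrow> proj (coords p) = proj (N *v coords p)"
    by (auto simp: proj_map_def proj_coords)
  also have "\<dots> \<longleftrightarrow> (\<exists>c. c \<noteq> 0 \<and> N *v coords p = c *s coords p)"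
    by (rule proj_eq_iff[OF coords_nonzero nz])
  also have "\<dots> \<longleftrightarrow> (\<exists>m. N *v coords p = m *s coords p)"
    using nz by auto
  finally show ?thesis .
qed

lemma tor_fixed_iff:
  assumes "l \<noteq> 0" "l \<noteq> 1"
  shows "tor l l p = p \<longleftrightarrow> coords p $ 3 = 0 \<or> p = basis_pt 3"
proof -
  obtain v where v: "v \<noteq> 0" "p = proj v"
    by (rule cp2_cases)
  have nz: "vector [l * v $ 1, l * v $ 2, v $ 3] \<noteq> (0 :: complex^3)"
    using v(1) assms by (simp add: zero_vec3_iff)
  have "tor l l p = p \<longleftrightarrow> proj v = proj (vector [l * v $ 1, l * v $ 2, v $ 3])"
    using v assms by (auto simp: tor_proj)
  also have "\<dots> \<longleftrightarrow> (\<exists>c. c \<noteq> 0 \<and> vector [l * v $ 1, l * v $ 2, v $ 3] = c *s v)"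
    by (rule proj_eq_iff[OF v(1) nz])
  also have "\<dots> \<longleftrightarrow> v $ 3 = 0 \<or> (v $ 1 = 0 \<and> v $ 2 = 0)"
  proof
    assume "\<exists>c. c \<noteq> 0 \<and> vector [l * v $ 1, l * v $ 2, v $ 3] = c *s v"
    then obtain c where "l * v $ 1 = c * v $ 1" "l * v $ 2 = c * v $ 2" "v $ 3 = c * v $ 3"
      by (auto simp: vec_eq_iff forall_3)
    then show "v $ 3 = 0 \<or> (v $ 1 = 0 \<and> v $ 2 = 0)"
      using assms(2) by (cases "v $ 3 = 0") simp_all
  next
    assume "v $ 3 = 0 \<or> (v $ 1 = 0 \<and> v $ 2 = 0)"
    then show "\<exists>c. c \<noteq> 0 \<and> vector [l * v $ 1, l * v $ 2, v $ 3] = c *s v"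
    proof
      assume "v $ 3 = 0"
      then show ?thesis
        using assms(1) by (intro exI[of _ l]) (simp add: vec_eq_iff forall_3)
    next
      assume "v $ 1 = 0 \<and> v $ 2 = 0"
      then show ?thesis
        by (intro exI[of _ 1]) (simp add: vec_eq_iff forall_3)
    qed
  qed
  also have "\<dots> \<longleftrightarrow> v $ 3 = 0 \<or> proj (vector [0, 0, 1]) = proj v"
    using v(1) by (auto simp: proj_eq_iff basis_vec_nonzero vec_eq_iff forall_3)
  finally show ?thesis
    by (auto simp: basis_pt_eq v coords_proj_zero_iff)
qed

lemma norm_mult_cnj_eq_1: "c * cnj d = 1 \<Longrightarrow> cmod c * cmod d = 1"
  by (metis complex_mod_cnj norm_mult norm_one)

lemma norm_not_minus_1: "cmod z \<noteq> - 1"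
  using norm_ge_zero[of z] by linarith

text \<open>The map \<open>tor l l\<close> is a homology: it fixes the line \<open>z\<^sub>3 = 0\<close> pointwise and one further point, the
  basis point \<open>e\<^sub>3\<close>. The locale describes a projective map that is conjugate to it by a mere homeomorphism.\<close>

locale conjugated_homology =
  fixes \<phi> \<psi> :: "cp2 \<Rightarrow> cp2" and l :: complex and N :: "complex^3^3"
  assumes homeo: "homeomorphism UNIV UNIV \<phi> \<psi>"
    and l: "l \<noteq> 0" "cmod l < 1"
    and det: "det N \<noteq> 0"
    and conj: "\<psi> \<circ> tor l l \<circ> \<phi> = proj_map N"
begin

lemma inverse_maps [simp]: "\<psi> (\<phi> p) = p" "\<phi> (\<psi> p) = p"
  using homeo by (auto simp: homeomorphism_def)

lemma map_eq: "proj_map N (\<psi> p) = \<psi> (tor l l p)"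
  using fun_cong[OF conj, of "\<psi> p"] by simp

lemma continuous_maps: "continuous_on UNIV \<phi>" "continuous_on UNIV \<psi>"
  using homeo by (auto simp: homeomorphism_def)

lemma fixed_iff: "proj_map N q = q \<longleftrightarrow> coords (\<phi> q) $ 3 = 0 \<or> \<phi> q = basis_pt 3"
proof -
  have "proj_map N q = q \<longleftrightarrow> tor l l (\<phi> q) = \<phi> q"
    using map_eq[of "\<phi> q"] by (metis inverse_maps)
  moreover have "l \<noteq> 1"
    using l by auto
  ultimately show ?thesis
    using tor_fixed_iff[OF l(1)] by simp
qed

lemma eigenvalue_exists:
  assumes "coords p $ 3 = 0 \<or> p = basis_pt 3"
  shows "\<exists>m. N *v coords (\<psi> p) = m *s coords (\<psi> p)"
  using fixed_iff[of "\<psi> p"] proj_map_fixed_iff[OF det] assms by simp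

lemma \<psi>_eq_iff: "\<psi> p = \<psi> q \<longleftrightarrow> p = q"
  by (metis inverse_maps(2))

lemma proj_coords_\<psi>: "proj (coords (\<psi> p)) = proj (coords (\<psi> q)) \<longleftrightarrow> p = q"
  by (simp add: proj_coords \<psi>_eq_iff)

text \<open>If \<open>\<psi> p\<close> and \<open>\<psi> e\<^sub>3\<close> had the same eigenvalue, the projective line through them would consist of fixed
  points. Then \<open>\<psi> e\<^sub>3\<close> would be a limit of other fixed points, whereas \<open>e\<^sub>3\<close> is an isolated fixed point
  of the original map.\<close>

lemma isolated_eigenvalue:
  assumes p: "coords p $ 3 = 0"
    and m: "N *v coords (\<psi> p) = m *s coords (\<psi> p)"
    and n: "N *v coords (\<psi> (basis_pt 3)) = n *s coords (\<psi> (basis_pt 3))"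
  shows "m \<noteq> n"
proof
  assume "m = n"
  define u v where "u = coords (\<psi> p)" and "v = coords (\<psi> (basis_pt 3))"
  have "p \<noteq> basis_pt 3"
    using p coords_basis_pt_3 by auto
  then have uv: "proj v \<noteq> proj u" "v \<noteq> 0" "u \<noteq> 0"
    by (auto simp: u_def v_def proj_coords_\<psi> coords_nonzero)
  define s where "s = (\<lambda>k. of_real (inverse (real (Suc k))) :: complex)"
  have s: "s \<longlonglongrightarrow> 0" "s k \<noteq> 0" for k
    using tendsto_of_real[OF LIMSEQ_inverse_real_of_nat, where 'a = complex] by (simp_all add: s_def del: of_nat_Suc)
  \<comment> \<open>The points \<open>proj (w k)\<close> are fixed, differ from \<open>proj v\<close> and converge to it.\<close>
  define w where "w = (\<lambda>k. v + s k *s u)"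
  have w: "w k \<noteq> 0" for k
    using proj_neq_independent[OF uv, of 1 "s k"] by (auto simp: w_def)
  have "w \<longlonglongrightarrow> v"
  proof (rule vec_tendstoI)
    fix i
    have "(\<lambda>k. v $ i + s k * u $ i) \<longlonglongrightarrow> v $ i + 0 * u $ i"
      by (intro tendsto_intros s)
    then show "(\<lambda>k. w k $ i) \<longlonglongrightarrow> v $ i"
      by (simp add: w_def)
  qed
  then have "(\<lambda>k. proj (w k)) \<longlonglongrightarrow> proj v"
    by (rule tendsto_proj[OF _ uv(2)])
  then have "(\<lambda>k. \<phi> (proj (w k))) \<longlonglongrightarrow> \<phi> (proj v)"
    by (rule continuous_on_tendsto_compose[OF continuous_maps(1)]) simp_all
  moreover have "\<phi> (proj v) = basis_pt 3"
    by (simp add: v_def proj_coords)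
  ultimately have "\<forall>\<^sub>F k in sequentially. \<phi> (proj (w k)) \<in> {p. coords p $ 3 \<noteq> 0}"
    using topological_tendstoD[OF _ open_coord_nonzero] coords_basis_pt_3(3) by simp
  then obtain k where k: "coords (\<phi> (proj (w k))) $ 3 \<noteq> 0"
    by (auto dest: eventually_happens)
  have "N *v w k = n *s w k"
    using m n \<open>m = n\<close> unfolding w_def u_def v_def
    by (simp add: matrix_vector_right_distrib vector_scalar_commute vec_eq_iff algebra_simps)
  moreover have "n \<noteq> 0"
    using calculation matrix_mult_nonzero[OF det w[of k]] by auto
  ultimately have "proj_map N (proj (w k)) = proj (w k)"
    using proj_scale[OF _ w[of k]] by (simp add: proj_map_proj[OF det w[of k]])
  then have "\<phi> (proj (w k)) = basis_pt 3"
    using fixed_iff[of "proj (w k)"] k by simp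
  then have "proj (w k) = proj v"
    by (metis inverse_maps(1) proj_coords v_def)
  then obtain c where c: "v = c *s w k"
    using proj_eq_iff[OF w[of k] uv(2)] by auto
  have "(c - 1) *s v + (c * s k) *s u = 0"
    using c[unfolded w_def] by (simp add: vec_eq_iff algebra_simps)
  then have "c - 1 = 0 \<and> c * s k = 0"
    by (rule proj_neq_independent[OF uv])
  then show False
    using s(2)[of k] by auto
qed

text \<open>The eigenvalue \<open>m\<close> belongs to the image of the fixed line, \<open>n\<close> to that of the isolated fixed point.\<close>

definition eigenvalue_pair :: "complex \<Rightarrow> complex \<Rightarrow> bool" where
  "eigenvalue_pair m n \<longleftrightarrow> m \<noteq> n \<and>
    (\<forall>p. coords p $ 3 = 0 \<longrightarrow> N *v coords (\<psi> p) = m *s coords (\<psi> p)) \<and>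
    N *v coords (\<psi> (basis_pt 3)) = n *s coords (\<psi> (basis_pt 3))"

text \<open>The fixed line has infinitely many points but \<open>N\<close> has only finitely many eigenvalues, so two points
  of the line have images with the same eigenvalue \<open>m\<close>. Their eigenvectors and the one of the isolated fixed
  point form a basis, in which an eigenvector with an eigenvalue other than \<open>m\<close> must be a multiple of
  the last basis vector. As \<open>\<psi>\<close> is injective, this excludes all images of points of the line.\<close>

lemma eigenvalue_pair_exists:
  obtains m n where "eigenvalue_pair m n"
proof -
  define q where "q = (\<lambda>t :: complex. proj (vector [1, t, 0]))"
  have nz: "vector [1, t, 0] \<noteq> (0 :: complex^3)" for t
    by (simp add: zero_vec3_iff)
  have q3: "coords (q t) $ 3 = 0" for t
    by (simp add: q_def coords_proj_zero_iff nz)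
  have q_inj: "q s = q t \<Longrightarrow> s = t" for s t
    by (auto simp: q_def proj_eq_iff nz vec_eq_iff forall_3)
  obtain k where k: "\<And>t. N *v coords (\<psi> (q t)) = k t *s coords (\<psi> (q t))"
    using eigenvalue_exists[OF disjI1[OF q3]] by metis
  have "range k \<subseteq> {m. \<exists>v. v \<noteq> 0 \<and> N *v v = m *s v}"
    using k coords_nonzero by auto
  then have "\<not> inj k"
    using finite_subset[OF _ finite_eigenvalues] finite_imageD infinite_UNIV_char_0 by blast
  then obtain s t where st: "s \<noteq> t" "k s = k t"
    by (auto simp: inj_def)
  define u v where "u = coords (\<psi> (q s))" and "v = coords (\<psi> (q t))"
  define m where "m = k s"
  have uv: "N *v u = m *s u" "N *v v = m *s v" "proj u \<noteq> proj v" "u \<noteq> 0" "v \<noteq> 0"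
    using k st q_inj by (auto simp: u_def v_def m_def proj_coords_\<psi> coords_nonzero)
  define w where "w = coords (\<psi> (basis_pt 3))"
  obtain n where n: "N *v w = n *s w"
    using eigenvalue_exists[of "basis_pt 3"] by (auto simp: w_def)
  have w: "w \<noteq> 0"
    by (simp add: w_def coords_nonzero)
  have mn: "m \<noteq> n"
    using isolated_eigenvalue[OF q3 uv(1)[unfolded u_def] n[unfolded w_def]] .
  have indep: "\<forall>x y z. x *s u + y *s v + z *s w = 0 \<longrightarrow> x = 0 \<and> y = 0 \<and> z = 0"
    using eigenvectors_independent[OF uv(1,2) n mn w uv(3-5)] by blast
  obtain Q :: "complex^3^3" where Q: "\<forall>t. t = (Q *v t) $ 1 *s u + (Q *v t) $ 2 *s v + (Q *v t) $ 3 *s w"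
    using dual_basis[OF indep] by (elim exE conjE)
  have "N *v coords (\<psi> p) = m *s coords (\<psi> p)" if p: "coords p $ 3 = 0" for p
  proof -
    define r where "r = coords (\<psi> p)"
    obtain k where k: "N *v r = k *s r"
      using eigenvalue_exists p by (auto simp: r_def)
    obtain x y z where xyz: "r = x *s u + y *s v + z *s w"
      using Q by blast
    have "k = m"
    proof (rule ccontr)
      assume "k \<noteq> m"
      have "0 = N *v r - k *s r"
        by (simp add: k)
      also have "\<dots> = ((m - k) * x) *s u + ((m - k) * y) *s v + ((n - k) * z) *s w"
        using uv(1,2) n unfolding xyz
        by (simp add: matrix_vector_right_distrib vector_scalar_commute vec_eq_iff algebra_simps)
      finally have "(m - k) * x = 0 \<and> (m - k) * y = 0 \<and> (n - k) * z = 0"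
        by (intro eigenvectors_independent[OF uv(1,2) n mn w uv(3-5)]) simp
      then have r: "r = z *s w"
        using \<open>k \<noteq> m\<close> by (simp add: xyz)
      then have "proj r = proj w"
        using proj_scale[OF _ w, of z] coords_nonzero[of "\<psi> p"] by (auto simp: r_def)
      then have "p = basis_pt 3"
        unfolding r_def w_def proj_coords_\<psi> .
      then show False
        using p coords_basis_pt_3(3) by simp
    qed
    then show ?thesis
      using k by (simp add: r_def)
  qed
  then show ?thesis
    using that[of m n] mn n by (simp add: w_def eigenvalue_pair_def)
qed

lemma eigenvalue_pairD:
  assumes "eigenvalue_pair m n"
  shows "m \<noteq> n" "N *v coords (\<psi> (basis_pt 1)) = m *s coords (\<psi> (basis_pt 1))"
    "N *v coords (\<psi> (basis_pt 2)) = m *s coords (\<psi> (basis_pt 2))"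
    "N *v coords (\<psi> (basis_pt 3)) = n *s coords (\<psi> (basis_pt 3))"
  using assms coords_basis_pt_3 unfolding eigenvalue_pair_def by blast+


lemma independent_images:
  assumes "eigenvalue_pair m n"
    "x *s coords (\<psi> (basis_pt 1)) + y *s coords (\<psi> (basis_pt 2)) + z *s coords (\<psi> (basis_pt 3)) = 0"
  shows "x = 0 \<and> y = 0 \<and> z = 0"
  by (rule eigenvectors_independent[OF eigenvalue_pairD(2,3,4,1)[OF assms(1)] _ _ _ _ assms(2)])
     (simp_all add: coords_nonzero proj_coords_\<psi> basis_pt_distinct)

lemma images_span:
  "\<exists>x y z. t = x *s coords (\<psi> (basis_pt 1)) + y *s coords (\<psi> (basis_pt 2)) + z *s coords (\<psi> (basis_pt 3))"
proof -
  obtain m n where mn: "eigenvalue_pair m n"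
    by (rule eigenvalue_pair_exists)
  show ?thesis
    using dual_basis[of "coords (\<psi> (basis_pt 1))" "coords (\<psi> (basis_pt 2))" "coords (\<psi> (basis_pt 3))"]
      independent_images[OF mn] by blast
qed

lemma tor_iterate: "(tor l l ^^ k) p = tor (l ^ k) (l ^ k) p"
  by (induction k) (simp_all add: tor_1 tor_tor l)

lemma tor_iterates_tendsto:
  assumes "coords p $ 3 \<noteq> 0"
  shows "(\<lambda>k. tor (l ^ k) (l ^ k) p) \<longlonglongrightarrow> basis_pt 3"
proof -
  obtain v where v: "v \<noteq> 0" "p = proj v"
    by (rule cp2_cases)
  then have v3: "v $ 3 \<noteq> 0"
    using assms by (simp add: coords_proj_zero_iff)
  have lim: "(\<lambda>k. l ^ k) \<longlonglongrightarrow> 0"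
    by (rule LIMSEQ_power_zero) (rule l)
  have "(\<lambda>k. vector [l ^ k * v $ 1, l ^ k * v $ 2, v $ 3] :: complex^3) \<longlonglongrightarrow> v $ 3 *s vector [0, 0, 1]"
  proof (rule vec_tendstoI)
    fix i :: 3
    have "(\<lambda>k. l ^ k * c) \<longlonglongrightarrow> 0 * c" for c
      by (intro tendsto_intros lim)
    then show "(\<lambda>k. (vector [l ^ k * v $ 1, l ^ k * v $ 2, v $ 3] :: complex^3) $ i)
        \<longlonglongrightarrow> (v $ 3 *s vector [0, 0, 1]) $ i"
      using exhaust_3[of i] by auto
  qed
  then have "(\<lambda>k. proj (vector [l ^ k * v $ 1, l ^ k * v $ 2, v $ 3]))
      \<longlonglongrightarrow> proj (v $ 3 *s vector [0, 0, 1])"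
    by (rule tendsto_proj) (simp add: v3 basis_vec_nonzero)
  then show ?thesis
    using l v v3 by (simp add: tor_proj proj_scale basis_vec_nonzero basis_pt_eq)
qed

lemma iterates_tendsto:
  assumes "coords (\<phi> q) $ 3 \<noteq> 0"
  shows "(\<lambda>k. (proj_map N ^^ k) q) \<longlonglongrightarrow> \<psi> (basis_pt 3)"
proof -
  have "(proj_map N ^^ k) q = \<psi> (tor (l ^ k) (l ^ k) (\<phi> q))" for k
    unfolding tor_iterate[symmetric] by (induction k) (simp_all add: map_eq)
  then show ?thesis
    using continuous_on_tendsto_compose[OF continuous_maps(2) tor_iterates_tendsto[OF assms]] by simp
qed

text \<open>The orbit of \<open>[u + w]\<close> consists of the points \<open>[m^k u + n^k w]\<close> and must converge to \<open>[w]\<close>. If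
  the absolute values agreed, the orbit would never enter the neighbourhood of \<open>[w]\<close> where the coordinate along
  \<open>w\<close> is larger than the one along \<open>u\<close>.\<close>

lemma eigenvalue_norms_differ:
  assumes mn: "eigenvalue_pair m n"
  shows "cmod m \<noteq> cmod n"
proof
  assume norms: "cmod m = cmod n"
  define u v w where "u = coords (\<psi> (basis_pt 1))" and "v = coords (\<psi> (basis_pt 2))"
    and "w = coords (\<psi> (basis_pt 3))"
  have eig: "N *v u = m *s u" "N *v w = n *s w"
    using eigenvalue_pairD[OF mn] by (simp_all add: u_def w_def)
  obtain Q :: "complex^3^3" where Q: "Q *v (x *s u + y *s v + z *s w) = vector [x, y, z]" for x y z
    using dual_basis[of u v w] independent_images[OF mn] unfolding u_def v_def w_def by blast
  define U where "U = {p. cmod ((Q *v coords p) $ 1) < cmod ((Q *v coords p) $ 3)}"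
  have hom: "cmod ((Q *v (c *s t)) $ 1) < cmod ((Q *v (c *s t)) $ 3) \<longleftrightarrow>
      cmod ((Q *v t) $ 1) < cmod ((Q *v t) $ 3)" if "c \<noteq> 0" for c t
    using that by (simp add: vector_scalar_commute norm_mult)
  have "open {t. t \<noteq> 0 \<and> cmod ((Q *v t) $ 1) < cmod ((Q *v t) $ 3)}"
    by (intro open_Collect_conj open_Collect_neq open_Collect_less continuous_intros
        continuous_on_matrix_vector_mult)
  then have "open U"
    unfolding U_def using hom by (intro open_cp2_homogeneous)
  have U: "proj t \<in> U \<longleftrightarrow> cmod ((Q *v t) $ 1) < cmod ((Q *v t) $ 3)" if "t \<noteq> 0" for t
    unfolding U_def mem_Collect_eq
    by (rule homogeneous_coords_iff[of "\<lambda>t. cmod ((Q *v t) $ 1) < cmod ((Q *v t) $ 3)"])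
       (use hom that in auto)
  have Qw: "Q *v w = vector [0, 0, 1]"
    using Q[of 0 0 1] by simp
  have wU: "\<psi> (basis_pt 3) \<in> U"
  proof -
    have "w \<noteq> 0" "proj w = \<psi> (basis_pt 3)"
      by (simp_all add: w_def coords_nonzero proj_coords)
    then show ?thesis
      using U[of w] by (simp add: Qw)
  qed
  define t where "t = (\<lambda>k. m ^ k *s u + n ^ k *s w)"
  have Qt: "Q *v t k = vector [m ^ k, 0, n ^ k]" for k
    using Q[of "m ^ k" 0 "n ^ k"] by (simp add: t_def)
  have nonzero: "m \<noteq> 0" "n \<noteq> 0"
    using matrix_mult_nonzero[OF det, of u] eig(1) norms by (auto simp: u_def coords_nonzero)
  then have "(Q *v t k) $ 1 \<noteq> 0" for k
    by (simp add: Qt)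
  then have t: "t k \<noteq> 0" for k
    by (metis matrix_vector_mult_0_right zero_index)
  have iter: "(proj_map N ^^ k) (proj (t 0)) = proj (t k)" for k
  proof (induction k)
    case (Suc k)
    have "N *v t k = t (Suc k)"
      using eig by (simp add: t_def matrix_vector_right_distrib vector_scalar_commute
          vec_eq_iff algebra_simps)
    then show ?case
      using Suc by (simp add: proj_map_proj[OF det t])
  qed simp
  have "proj_map N (proj (t 0)) \<noteq> proj (t 0)"
  proof
    assume "proj_map N (proj (t 0)) = proj (t 0)"
    then have "proj (t 0) = proj (t 1)"
      using iter[of 1] by simp
    then obtain c where "t 1 = c *s t 0"
      using proj_eq_iff[OF t t] by blast
    then have "Q *v t 1 = c *s (Q *v t 0)"
      by (simp add: vector_scalar_commute)
    then have "m = c" "n = c"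
      unfolding Qt by (simp_all add: vec_eq_iff forall_3)
    then show False
      using eigenvalue_pairD(1)[OF mn] by simp
  qed
  then have "coords (\<phi> (proj (t 0))) $ 3 \<noteq> 0"
    using fixed_iff by blast
  then have "(\<lambda>k. proj (t k)) \<longlonglongrightarrow> \<psi> (basis_pt 3)"
    by (rule iterates_tendsto[of "proj (t 0)", unfolded iter])
  then have "\<forall>\<^sub>F k in sequentially. proj (t k) \<in> U"
    using \<open>open U\<close> wU by (rule topological_tendstoD)
  then obtain k where "proj (t k) \<in> U"
    by (auto dest: eventually_happens)
  then show False
    using norms by (simp add: U[OF t] Qt norm_power)
qed

text \<open>If \<open>cmod m \<noteq> 1\<close>, the two-dimensional eigenspace is isotropic; but it meets the plane \<open>z\<^sub>3 = 0\<close>, on which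
  the form is positive definite. So \<open>cmod m = 1\<close>; if \<open>cmod n \<noteq> 1\<close>, the other eigenvector is orthogonal
  to the eigenspace and to itself, which contradicts nondegeneracy.\<close>

lemma not_herm21_preserving: "\<exists>v w. herm21 (N *v v) (N *v w) \<noteq> herm21 v w"
proof (rule ccontr)
  assume "\<nexists>v w. herm21 (N *v v) (N *v w) \<noteq> herm21 v w"
  then have herm: "herm21 (N *v v) (N *v w) = herm21 v w" for v w
    by blast
  obtain m n where mn: "eigenvalue_pair m n"
    by (rule eigenvalue_pair_exists)
  define u v w where "u = coords (\<psi> (basis_pt 1))" and "v = coords (\<psi> (basis_pt 2))"
    and "w = coords (\<psi> (basis_pt 3))"
  have eig: "N *v u = m *s u" "N *v v = m *s v" "N *v w = n *s w"
    using eigenvalue_pairD[OF mn] by (simp_all add: u_def v_def w_def)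
  have scale: "herm21 (c *s x) (d *s y) = c * cnj d * herm21 x y" for c d x y
    by (simp add: herm21_def algebra_simps)
  have m1: "cmod m = 1"
  proof (rule ccontr)
    assume "cmod m \<noteq> 1"
    then have "m * cnj m \<noteq> 1"
      using norm_mult_cnj_eq_1[of m m] norm_not_minus_1[of m] by (auto simp: square_eq_1_iff)
    have iso: "herm21 e e = 0" if "N *v e = m *s e" for e
      using herm[of e e] \<open>m * cnj m \<noteq> 1\<close> by (simp add: that scale)
    obtain x y where xy: "x * u $ 3 + y * v $ 3 = 0" "x \<noteq> 0 \<or> y \<noteq> 0"
    proof (cases "u $ 3 = 0")
      case True
      then show ?thesis
        using that[of 1 0] by simp
    next
      case False
      then show ?thesis
        using that[of "v $ 3" "- u $ 3"] by (simp add: algebra_simps)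
    qed
    define e where "e = x *s u + y *s v"
    have "N *v e = m *s e"
      using eig by (simp add: e_def matrix_vector_right_distrib vector_scalar_commute vec_eq_iff algebra_simps)
    then have "herm21 e e = 0"
      by (rule iso)
    moreover have "e $ 3 = 0"
      using xy(1) by (simp add: e_def)
    ultimately have "complex_of_real ((cmod (e $ 1))\<^sup>2 + (cmod (e $ 2))\<^sup>2) = 0"
      by (simp only: of_real_add complex_norm_square) (simp add: herm21_def)
    then have "(cmod (e $ 1))\<^sup>2 + (cmod (e $ 2))\<^sup>2 = 0"
      by (simp only: of_real_eq_0_iff)
    then have "e $ 1 = 0" "e $ 2 = 0"
      by (simp_all add: sum_power2_eq_zero_iff)
    with \<open>e $ 3 = 0\<close> have "x *s u + y *s v + 0 *s w = 0"
      by (simp add: e_def zero_vec3_iff)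
    then show False
      using independent_images[OF mn, of x y 0] xy(2) by (simp add: u_def v_def w_def)
  qed
  have "cmod n = 1"
  proof (rule ccontr)
    assume "cmod n \<noteq> 1"
    then have neq: "c * cnj n \<noteq> 1" if "cmod c = 1 \<or> c = n" for c
      using that norm_mult_cnj_eq_1[of c n] norm_not_minus_1[of n] by (auto simp: square_eq_1_iff)
    have orth: "herm21 e w = 0" if "N *v e = c *s e" "cmod c = 1 \<or> c = n" for e c
      using herm[of e w] neq[OF that(2)] by (simp add: that eig scale)
    have *: "herm21 u w = 0" "herm21 v w = 0" "herm21 w w = 0"
      using orth[OF eig(1)] orth[OF eig(2)] orth[OF eig(3)] m1 by auto
    have zero: "herm21 t w = 0" for t
    proof -
      obtain x y z where t: "t = x *s u + y *s v + z *s w"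
        using images_span unfolding u_def v_def w_def by blast
      have "herm21 t w = x * herm21 u w + y * herm21 v w + z * herm21 w w"
        unfolding t herm21_def by (simp add: algebra_simps)
      then show ?thesis
        by (simp add: *)
    qed
    have "herm21 (axis i 1) w = (if i = 3 then - 1 else 1) * cnj (w $ i)" for i
      using exhaust_3[of i] by (auto simp: herm21_def axis_3_eq)
    then have "w $ i = 0" for i
      using zero[of "axis i 1"] by (simp split: if_splits)
    then show False
      using coords_nonzero[of "\<psi> (basis_pt 3)"] by (simp add: w_def vec_eq_iff)
  qed
  then show False
    using eigenvalue_norms_differ[OF mn] m1 by simp
qed

text \<open>The images of the three basis points span the whole space.\<close>

lemma no_line_through_images:
  "\<not> (coords (\<psi> (basis_pt 1)) $ 3 = 0 \<and> coords (\<psi> (basis_pt 2)) $ 3 = 0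
    \<and> coords (\<psi> (basis_pt 3)) $ 3 = 0)"
proof
  assume *: "coords (\<psi> (basis_pt 1)) $ 3 = 0 \<and> coords (\<psi> (basis_pt 2)) $ 3 = 0
    \<and> coords (\<psi> (basis_pt 3)) $ 3 = 0"
  obtain x y z where "vector [0, 0, 1] = x *s coords (\<psi> (basis_pt 1)) + y *s coords (\<psi> (basis_pt 2))
      + z *s coords (\<psi> (basis_pt 3))"
    using images_span by blast
  then have "(vector [0, 0, 1] :: complex^3) $ 3 = 0"
    using * by simp
  then show False
    by simp
qed

end

section \<open>Topological conjugacy to complex hyperbolic and affine groups\<close>

text \<open>The projective conjugation is itself a homeomorphism and is absorbed into the topological one.\<close>

lemma conjugate_into_reduction:
  assumes "topologically_conjugate \<Gamma> \<Gamma>'" "conjugate_into \<Gamma>' H"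
  shows "\<exists>\<phi> \<psi>. homeomorphism UNIV UNIV \<phi> \<psi> \<and> (\<forall>\<gamma>\<in>\<Gamma>. \<psi> \<circ> \<gamma> \<circ> \<phi> \<in> H)"
proof -
  obtain \<phi> \<psi> where homeo: "homeomorphism UNIV UNIV \<phi> \<psi>" and \<Gamma>': "\<Gamma>' = (\<lambda>\<gamma>. \<psi> \<circ> \<gamma> \<circ> \<phi>) ` \<Gamma>"
    using assms(1) by (auto simp: topologically_conjugate_def)
  obtain g where g: "g \<in> carrier PSL3"
    and H: "\<forall>\<gamma>\<in>\<Gamma>'. inv\<^bsub>PSL3\<^esub> g \<otimes>\<^bsub>PSL3\<^esub> \<gamma> \<otimes>\<^bsub>PSL3\<^esub> g \<in> H"
    using assms(2) by (auto simp: conjugate_into_def)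
  have "homeomorphism UNIV UNIV (\<phi> \<circ> g) (inv\<^bsub>PSL3\<^esub> g \<circ> \<psi>)"
    by (rule homeomorphism_compose[OF PSL3_homeomorphism[OF g] homeo])
  moreover have "(inv\<^bsub>PSL3\<^esub> g \<circ> \<psi>) \<circ> \<gamma> \<circ> (\<phi> \<circ> g) \<in> H" if "\<gamma> \<in> \<Gamma>" for \<gamma>
  proof -
    have "inv\<^bsub>PSL3\<^esub> g \<otimes>\<^bsub>PSL3\<^esub> (\<psi> \<circ> \<gamma> \<circ> \<phi>) \<otimes>\<^bsub>PSL3\<^esub> g \<in> H"
      using H that unfolding \<Gamma>' by blast
    then show ?thesis
      by (simp only: PSL3_simps comp_assoc)
  qed
  ultimately show ?thesis
    by blast
qed

lemma tor_in_lattice_group_1: "tor l l \<in> lattice_group l"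
  using tor_in_lattice_group[of l 1 1] by simp

theorem not_conjugate_complex_hyperbolic:
  assumes l: "l \<noteq> 0" "cmod l < 1"
  shows "\<not> (\<exists>\<Gamma>'. complex_hyperbolic \<Gamma>' \<and> topologically_conjugate (lattice_group l) \<Gamma>')"
proof clarify
  fix \<Gamma>' assume "complex_hyperbolic \<Gamma>'" and top: "topologically_conjugate (lattice_group l) \<Gamma>'"
  then have "conjugate_into \<Gamma>' PU21"
    by (simp add: complex_hyperbolic_def)
  then obtain \<phi> \<psi> where homeo: "homeomorphism UNIV UNIV \<phi> \<psi>"
    and PU: "\<forall>\<gamma>\<in>lattice_group l. \<psi> \<circ> \<gamma> \<circ> \<phi> \<in> PU21"
    using conjugate_into_reduction[OF top] by blast
  obtain N where N: "\<psi> \<circ> tor l l \<circ> \<phi> = proj_map N" "det N = 1"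
    "\<forall>v w. herm21 (N *v v) (N *v w) = herm21 v w"
    using PU[rule_format, OF tor_in_lattice_group_1] unfolding PU21_def mem_Collect_eq by blast
  interpret conjugated_homology \<phi> \<psi> l N
    by unfold_locales (use homeo l N in auto)
  show False
    using not_herm21_preserving N(3) by blast
qed

text \<open>The set \<open>S\<close> of points which \<open>\<psi>\<close> sends to the line at infinity is closed and invariant. Some power of the
  permutation moves a point of it off the line \<open>z\<^sub>3 = 0\<close>, and iterating \<open>tor l l\<close> then shows that \<open>e\<^sub>3\<close>, and
  with it every basis point, lies in \<open>S\<close>.\<close>

theorem not_conjugate_affine:
  assumes l: "l \<noteq> 0" "cmod l < 1"
  shows "\<not> (\<exists>\<Gamma>'. affine_group \<Gamma>' \<and> topologically_conjugate (lattice_group l) \<Gamma>')"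
proof clarify
  let ?H = "{g \<in> carrier PSL3. g ` range affine_pt = range affine_pt}"
  fix \<Gamma>' assume "affine_group \<Gamma>'" and top: "topologically_conjugate (lattice_group l) \<Gamma>'"
  then have "conjugate_into \<Gamma>' ?H"
    by (simp add: affine_group_def)
  then obtain \<phi> \<psi> where homeo: "homeomorphism UNIV UNIV \<phi> \<psi>"
    and H: "\<forall>\<gamma>\<in>lattice_group l. \<psi> \<circ> \<gamma> \<circ> \<phi> \<in> ?H"
    using conjugate_into_reduction[OF top] by blast
  have "\<psi> \<circ> tor l l \<circ> \<phi> \<in> carrier PSL3"
    using H tor_in_lattice_group_1 by blast
  then obtain N where N: "det N = 1" "\<psi> \<circ> tor l l \<circ> \<phi> = proj_map N"
    by (rule PSL3_cases)
  interpret conjugated_homology \<phi> \<psi> l N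
    by unfold_locales (use homeo l N in auto)
  define S where "S = {p. coords (\<psi> p) $ 3 = 0}"
  have inv: "\<gamma> p \<in> S" if \<gamma>: "\<gamma> \<in> lattice_group l" and p: "p \<in> S" for \<gamma> p
  proof (rule ccontr)
    define g where "g = \<psi> \<circ> \<gamma> \<circ> \<phi>"
    have g: "g \<in> carrier PSL3" "g ` range affine_pt = range affine_pt"
      using H \<gamma> by (auto simp: g_def)
    assume "\<gamma> p \<notin> S"
    then have "\<psi> (\<gamma> p) \<in> range affine_pt"
      by (simp add: S_def range_affine_pt)
    then have "g (\<psi> p) \<in> g ` range affine_pt"
      unfolding g(2) by (simp add: g_def)
    then have "\<psi> p \<in> range affine_pt"
      using PSL3_inverse(4)[OF g(1)] by (metis imageE)
    then show False
      using p by (simp add: S_def range_affine_pt)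
  qed
  have "open (\<psi> -` {p. coords p $ 3 \<noteq> 0})"
    by (intro open_vimage open_coord_nonzero continuous_maps)
  moreover have "- S = \<psi> -` {p. coords p $ 3 \<noteq> 0}"
    by (auto simp: S_def)
  ultimately have "closed S"
    by (simp add: closed_def)
  define p where "p = \<phi> (basis_pt 1)"
  have p: "p \<in> S"
    by (simp add: S_def p_def coords_basis_pt_3)
  have cyc_S: "cyc q \<in> S" if "q \<in> S" for q
    by (rule inv[OF cyc_in_lattice_group that])
  obtain q where q: "q \<in> S" "coords q $ 3 \<noteq> 0"
  proof -
    obtain v where v: "v \<noteq> 0" "p = proj v"
      by (rule cp2_cases)
    have nz: "vector [v $ 3, v $ 1, v $ 2] \<noteq> (0 :: complex^3)"
      "vector [v $ 2, v $ 3, v $ 1] \<noteq> (0 :: complex^3)"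
      using v(1) by (auto simp: zero_vec3_iff)
    have "coords p $ 3 = 0 \<longleftrightarrow> v $ 3 = 0" "coords (cyc p) $ 3 = 0 \<longleftrightarrow> v $ 2 = 0"
      "coords (cyc (cyc p)) $ 3 = 0 \<longleftrightarrow> v $ 1 = 0"
      using v nz by (simp_all add: cyc_proj coords_proj_zero_iff)
    then show ?thesis
      using that p cyc_S v(1) unfolding zero_vec3_iff by blast
  qed
  have "tor (l ^ k) (l ^ k) q \<in> S" for k
    using inv[OF tor_in_lattice_group[of l "int k" "int k"] q(1)] by simp
  then have "basis_pt 3 \<in> S"
    using Lim_in_closed_set[OF \<open>closed S\<close> _ _ tor_iterates_tendsto[OF q(2)]] by simp
  moreover from cyc_S[OF this] have "basis_pt 1 \<in> S"
    by (simp add: cyc_basis_pt)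
  moreover from cyc_S[OF this] have "basis_pt 2 \<in> S"
    by (simp add: cyc_basis_pt)
  ultimately show False
    using no_line_through_images by (simp add: S_def)
qed

lemma Gamma_a_normal_form:
  assumes "a \<noteq> 0" "cmod a \<noteq> 1"
  obtains l where "l \<noteq> 0" "cmod l < 1" "Gamma_a a = lattice_group l"
proof (cases "cmod a < 1")
  case True
  then show ?thesis
    using that[of "a ^ 3"] assms by (simp add: Gamma_a_eq norm_power power_less_one_iff)
next
  case False
  then have "cmod (inverse (a ^ 3)) < 1"
    using assms by (simp add: norm_inverse norm_power one_less_power inverse_less_1_iff)
  then show ?thesis
    using that[of "inverse (a ^ 3)"] assms by (simp add: Gamma_a_eq lattice_group_inverse)
qed

theorem proposition10p2:
  fixes a :: complex
  assumes "a \<noteq> 0" and "cmod a \<noteq> 1"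
  shows "Kulkarni_limit_set (Gamma_a a) =
           proj_line (basis_pt 1) (basis_pt 2) \<union> proj_line (basis_pt 1) (basis_pt 3)
             \<union> proj_line (basis_pt 3) (basis_pt 2)
       \<and> virtually_affine (Gamma_a a)
       \<and> \<not> (\<exists>\<Gamma>'. complex_hyperbolic \<Gamma>' \<and> topologically_conjugate (Gamma_a a) \<Gamma>')
       \<and> \<not> (\<exists>\<Gamma>'. affine_group \<Gamma>' \<and> topologically_conjugate (Gamma_a a) \<Gamma>')
       \<and> complex_orbifold (orbit_space (Gamma_a a) (Kulkarni_region (Gamma_a a)))
           (quotient_atlas (Gamma_a a) (Kulkarni_region (Gamma_a a)))
       \<and> compact_space (orbit_space (Gamma_a a) (Kulkarni_region (Gamma_a a)))
       \<and> singular_locus (Gamma_a a) (Kulkarni_region (Gamma_a a)) \<noteq> {}"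
proof -
  obtain l where l: "l \<noteq> 0" "cmod l < 1" and \<Gamma>: "Gamma_a a = lattice_group l"
    by (rule Gamma_a_normal_form[OF assms])
  have l1: "cmod l \<noteq> 1"
    using l by simp
  have limit: "Kulkarni_limit_set (Gamma_a a) = - torus"
    unfolding \<Gamma> by (rule Kulkarni_limit_set_lattice_group[OF l(1) l1])
  then have region: "Kulkarni_region (Gamma_a a) = torus"
    by (simp add: Kulkarni_region_def)
  have lines: "- torus = proj_line (basis_pt 1) (basis_pt 2) \<union> proj_line (basis_pt 1) (basis_pt 3)
      \<union> proj_line (basis_pt 3) (basis_pt 2)"
    using proj_line_basis_pt[of 1 2 3] proj_line_basis_pt[of 1 3 2] proj_line_basis_pt[of 3 2 1]
    by (auto simp: not_torus_eq)
  show ?thesis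
    unfolding region unfolding limit lines unfolding \<Gamma>
    using virtually_affine_lattice_group[OF l(1)] not_conjugate_complex_hyperbolic[OF l]
      not_conjugate_affine[OF l] compact_orbit_space[OF l] singular_locus_nonempty
      proper_action.complex_orbifold_orbit_space[OF proper_action_lattice_group[OF l(1) l1]]
    by blast
qed
end
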